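(* Let $\delta\in(0,1/3)$ and $\kappa:=R/r$. Let $(\ell_t)$ be any adversarial sequence of convex losses on $\mathcal{C}$, let $(x_t)$ be the iterates of the Projection-Free Wrapper in response to $(\ell_t)$, and let $g_s\in\partial\ell_s(x_s)$, $s\ge1$, be the observed subgradients. If the Wrapper is run with subroutine $\mathsf{A}$ set to FTRL-proximal with parameter $R$, with oracle $\mathcal{O}_{\mathcal{C}^\circ}=\mathsf{OPT}_{\mathcal{C}^\circ}$, and with tolerances $\delta_t=\delta/t^2$, $t\ge1$, then for all $T\ge1$ and $\rho\in(0,1)$ we have $x_t\in\mathcal{C}$ for all $t\in[T]$ and, with probability at least $1-\rho$, $$\forall x\in\mathcal{C},\qquad \sum_{t=1}^T\langle g_t,x_t-x\rangle\le 4(1+\kappa)R\sqrt{\sum_{t=1}^T\|g_t\|^2}+R\cdot\Big(12+\frac{10\delta}{\rho}\Big)\cdot\max_{t\le T}\|g_t\|.$$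
   Context: **Setting.** $\mathbb{R}^d$ carries the standard inner product and Euclidean norm $\|\cdot\|$; $\mathcal{B}(\rho)$ is the closed Euclidean ball of radius $\rho$ centered at $0$; $\mathcal{B}_\infty(u,\nu)$ is the closed $\ell_\infty$-ball of radius $\nu$ centered at $u$; $[n]=\{1,\dots,n\}$; $\mathbb{I}$ denotes an indicator; $\Pi_{\mathcal{B}(D)}$ is Euclidean projection onto $\mathcal{B}(D)$. $\mathcal{C}\subseteq\mathbb{R}^d$ is a closed convex set with $\mathcal{B}(r)\subseteq\mathcal{C}\subseteq\mathcal{B}(R)$ for some $0<r\le R$. **Online protocol.** At round $t\ge1$ the learner outputs $x_t\in\mathcal{C}$, then a convex loss $\ell_t:\mathcal{C}\to\mathbb{R}$ is revealed and a subgradient $g_t\in\partial\ell_t(x_t)$ is observed. The sequence is adversarial: $\ell_t$ may depend on $x_t$ and on $(x_s,\ell_s)_{s\in[t-1]}$. **Approximate Membership Oracle.** For $\epsilon>0$ let $\mathcal{B}(\mathcal{C},\epsilon)=\{x:\exists y\in\mathcal{C},\|x-y\|\le\epsilon\}$ and $\mathcal{B}(\mathcal{C},-\epsilon)=\{x:x+y\in\mathcal{C}\ \forall y\in\mathcal{B}(\epsilon)\}$. $\mathsf{MEM}(\cdot;\epsilon):\mathbb{R}^d\to\{0,1\}$ is any (deterministic) map equal to $1$ on $\mathcal{B}(\mathcal{C},-\epsilon)$ and to $0$ outside $\mathcal{B}(\mathcal{C},\epsilon)$. **$\mathsf{GAU}(w;\delta)$** (for $\delta\in(0,1)$, $w\in\mathcal{B}(6R/5)$):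 let $\epsilon=\delta r/(4\kappa)^2$. If $\mathsf{MEM}(2w;\epsilon)=1$ or $\|w\|\le r/2$, return $0$. Otherwise set $\alpha=0,\beta=2,\mu=1$; while $\beta-\alpha>\delta/(8\kappa^2)$: set $\alpha=\mu$ if $\mathsf{MEM}(\mu w;\epsilon)=1$ and $\beta=\mu$ otherwise, then $\mu=(\alpha+\beta)/2$. Return $(\alpha-\delta/(8\kappa^2))^{-1}$. **$\mathsf{OPT}_{\mathcal{C}^\circ}(w;\delta)$** (for $w\in\mathcal{B}(R)$, $\delta\in(0,1/3)$): let $\varepsilon=\frac{r^2\delta^3}{10^3d^{7/2}R^2}$, $\nu_1=\frac{r\delta}{10d}$, $\nu_2=\sqrt{\varepsilon\nu_1r/d^{1/2}}$. Sample (with fresh randomness at each call) $u$ uniformly in $\mathcal{B}_\infty(w,\nu_1)$ and then $z$ uniformly in $\mathcal{B}_\infty(u,\nu_2)$. For $i\in[d]$ let $w_i,w_i'$ be the endpoints of the segment $\mathcal{B}_\infty(u,\nu_2)\cap\{z+\lambda e_i:\lambda\in\mathbb{R}\}$, $w_i'$ having the larger $i$-th coordinate, and $\tilde s_i=\frac1{2\nu_2}(\mathsf{GAU}(w_i';\varepsilon)-\mathsf{GAU}(w_i;\varepsilon))$. Return $(\tilde\gamma,\tilde s)$ with $\tilde\gamma=\mathsf{GAU}(w;\delta)$, $\tilde s=(\tilde s_1,\dots,\tilde s_d)^\top$. **Projection-Free Wrapper** (inputs: an OCO algorithm $\mathsf{A}$ with outputs in $\mathcal{B}(R)$, tolerances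 $(\delta_t)\subset(0,1/3)$, oracle $\mathcal{O}_{\mathcal{C}^\circ}$ returning a pair in $\mathbb{R}_{\ge0}\times\mathbb{R}^d$). Let $w_1$ be the first output of $\mathsf{A}$. For $t=1,2,\dots$: set $(\gamma_t,s_t)=\mathcal{O}_{\mathcal{C}^\circ}(w_t;\delta_t)$ and $\nu_t=\mathbb{I}_{\{\gamma_t\ge1\}}s_t$; play $x_t=w_t/\gamma_t$ if $\gamma_t\ge1$ and $x_t=w_t$ otherwise; observe $g_t\in\partial\ell_t(x_t)$; set $\tilde g_t=g_t-\mathbb{I}_{\{\langle g_t,w_t\rangle<0\}}\langle g_t,x_t\rangle\nu_t$; give $\mathsf{A}$ the $t$-th loss $f_t(w)=\langle\tilde g_t,w\rangle$ and let $w_{t+1}$ be its next output. **FTRL-proximal with parameter $D$.** Outputs $w_1=0$; $G_0=0,V_0=0,\eta_0=\infty,\Sigma_0=0$. Upon observing a subgradient $\nabla_t$ of the $t$-th loss at $w_t$: $G_t=G_{t-1}+\nabla_t$, $V_t=V_{t-1}+\|\nabla_t\|^2$, $\eta_t=\sqrt2D/\sqrt{V_t}$, $\sigma_t=1/\eta_t-1/\eta_{t-1}$ (with $1/\infty=0$), $\Sigma_t=\Sigma_{t-1}+\sigma_t$, and $w_{t+1}=\Pi_{\mathcal{B}(D)}\big((-G_t+\sum_{s\le t}\sigma_sw_s)/\Sigma_t\big)$ (with $w_{t+1}=0$ if $\Sigma_t=0$). *)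

theory Defs
  imports "HOL-Probability.Probability" "HOL-Library.While_Combinator"
begin

definition subdifferential ::
    "'v::real_inner set \<Rightarrow> ('v \<Rightarrow> real) \<Rightarrow> 'v \<Rightarrow> 'v set" where
  "subdifferential C f x = {g. \<forall>y\<in>C. f y \<ge> f x + g \<bullet> (y - x)}"

definition linf_ball :: "real^'d \<Rightarrow> real \<Rightarrow> (real^'d) set" where
  "linf_ball u \<nu> = {z. \<forall>i. \<bar>z $ i - u $ i\<bar> \<le> \<nu>}"

definition outer_parallel :: "'v::real_normed_vector set \<Rightarrow> real \<Rightarrow> 'v set" where
  "outer_parallel C \<epsilon> = {x. \<exists>y\<in>C. norm (x - y) \<le> \<epsilon>}"

definition inner_parallel :: "'v::real_normed_vector set \<Rightarrow> real \<Rightarrow> 'v set" where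
  "inner_parallel C \<epsilon> = {x. \<forall>y\<in>cball 0 \<epsilon>. x + y \<in> C}"

text \<open>Oracle answers 1 and 0 are represented by True and False; points of the outer parallel body
  that are not in the inner one may be answered arbitrarily.\<close>

definition membership_oracle ::
    "'v::real_normed_vector set \<Rightarrow> ('v \<Rightarrow> real \<Rightarrow> bool) \<Rightarrow> bool" where
  "membership_oracle C mem \<longleftrightarrow>
     (\<forall>\<epsilon>>0. (\<forall>x\<in>inner_parallel C \<epsilon>. mem x \<epsilon>) \<and>
            (\<forall>x. x \<notin> outer_parallel C \<epsilon> \<longrightarrow> \<not> mem x \<epsilon>))"

definition gau ::
    "('v::real_normed_vector \<Rightarrow> real \<Rightarrow> bool) \<Rightarrow> real \<Rightarrow> real \<Rightarrow> 'v \<Rightarrow> real \<Rightarrow> real" where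
  "gau mem r R w \<delta> =
     (let \<kappa> = R / r; \<epsilon> = \<delta> * r / (4 * \<kappa>)\<^sup>2 in
      if mem (2 *\<^sub>R w) \<epsilon> \<or> norm w \<le> r / 2 then 0
      else
        let (\<alpha>, \<beta>, \<mu>) =
          while (\<lambda>(\<alpha>, \<beta>, \<mu>). \<beta> - \<alpha> > \<delta> / (8 * \<kappa>\<^sup>2))
            (\<lambda>(\<alpha>, \<beta>, \<mu>).
               let (\<alpha>', \<beta>') = (if mem (\<mu> *\<^sub>R w) \<epsilon> then (\<mu>, \<beta>) else (\<alpha>, \<mu>))
               in (\<alpha>', \<beta>', (\<alpha>' + \<beta>') / 2))
            (0, 2, 1)
        in inverse (\<alpha> - \<delta> / (8 * \<kappa>\<^sup>2)))"

text \<open>\<open>set_coord z i c\<close> is \<open>z\<close> with its \<open>i\<close>-th coordinate replaced by \<open>c\<close>. The lemma below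
  identifies the endpoints of the coordinate segments used in the finite differences.\<close>

definition set_coord :: "real^'d \<Rightarrow> 'd \<Rightarrow> real \<Rightarrow> real^'d" where
  "set_coord z i c = (\<chi> j. if j = i then c else z $ j)"

lemma linf_ball_coord_segment:
  fixes u z :: "real^'d"
  assumes z: "z \<in> linf_ball u \<nu>"
  shows "linf_ball u \<nu> \<inter> {z + l *\<^sub>R axis i 1 | l. True} =
         closed_segment (set_coord z i (u $ i - \<nu>)) (set_coord z i (u $ i + \<nu>))"
proof -
  have line: "z + l *\<^sub>R axis i 1 = set_coord z i (z $ i + l)" for l
    by (simp add: set_coord_def vec_eq_iff axis_def)
  have in_ball: "set_coord z i c \<in> linf_ball u \<nu> \<longleftrightarrow> c \<in> {u $ i - \<nu>..u $ i + \<nu>}" for c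
  proof -
    have "\<bar>z $ j - u $ j\<bar> \<le> \<nu>" for j using z by (auto simp: linf_ball_def)
    then show ?thesis
      by (auto simp: linf_ball_def set_coord_def abs_le_iff)
  qed
  have "\<bar>z $ i - u $ i\<bar> \<le> \<nu>" using z by (simp add: linf_ball_def)
  then have nu: "\<nu> \<ge> 0" by linarith
  have img: "set_coord z i ((1 - t) * a + t * b) =
      (1 - t) *\<^sub>R set_coord z i a + t *\<^sub>R set_coord z i b" for t a b
    by (simp add: set_coord_def vec_eq_iff algebra_simps)
  have "linf_ball u \<nu> \<inter> {z + l *\<^sub>R axis i 1 | l. True} =
      set_coord z i ` {u $ i - \<nu>..u $ i + \<nu>}"
  proof (intro equalityI subsetI)
    fix y assume "y \<in> set_coord z i ` {u $ i - \<nu>..u $ i + \<nu>}"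
    then obtain c where c: "y = set_coord z i c" "c \<in> {u $ i - \<nu>..u $ i + \<nu>}" by blast
    then have "y = z + (c - z $ i) *\<^sub>R axis i 1" by (simp add: line)
    with c show "y \<in> linf_ball u \<nu> \<inter> {z + l *\<^sub>R axis i 1 | l. True}"
      using in_ball by blast
  qed (auto simp: line in_ball)
  also have "{u $ i - \<nu>..u $ i + \<nu>} = closed_segment (u $ i - \<nu>) (u $ i + \<nu>)"
    using nu by (simp add: closed_segment_eq_real_ivl)
  also have "set_coord z i ` \<dots> =
      closed_segment (set_coord z i (u $ i - \<nu>)) (set_coord z i (u $ i + \<nu>))"
    by (simp only: closed_segment_image_interval image_image real_scaleR_def img)
  finally show ?thesis .
qed

lemma uniform_linf_ball_affine:
  fixes w :: "real^'d"
  assumes \<nu>: "\<nu> > 0"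
  shows "distr (uniform_measure lborel (linf_ball 0 1)) borel (\<lambda>a. w + \<nu> *\<^sub>R a) =
         uniform_measure lborel (linf_ball w \<nu>)"
proof -
  let ?T = "\<lambda>a :: real^'d. w + \<nu> *\<^sub>R a" and ?c = "ennreal (\<nu> ^ DIM(real^'d))"
  have cl [measurable]: "linf_ball u m \<in> sets borel" for u :: "real^'d" and m
    by (simp add: linf_ball_def)
  have T [measurable]: "?T \<in> borel_measurable borel" by simp
  have pre: "?T -` linf_ball w \<nu> = linf_ball 0 1"
    using \<nu> by (auto simp: linf_ball_def abs_mult)
  have scale: "emeasure lborel X = ?c * emeasure lborel (?T -` X)" if "X \<in> sets borel" for X
  proof -
    have "emeasure lborel X = emeasure (density (distr lborel borel ?T) (\<lambda>_. ?c)) X"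
      using arg_cong[OF lborel_affine[of \<nu> w], of "\<lambda>M. emeasure M X"] \<nu> by simp
    also have "\<dots> = ?c * emeasure (distr lborel borel ?T) X"
      using that by (subst emeasure_density) (simp_all add: nn_integral_cmult_indicator)
    also have "emeasure (distr lborel borel ?T) X = emeasure lborel (?T -` X)"
      using that by (subst emeasure_distr) simp_all
    finally show ?thesis .
  qed
  have cancel: "c * a / (c * b) = a / b" if "c \<noteq> 0" "c < top" for a b c :: ennreal
  proof -
    have "inverse (c * b) = inverse c * inverse b"
      using that by (intro ennreal_inverse_mult') (simp add: zero_less_iff_neq_zero)
    moreover have cc: "c * inverse c = 1"
      using that by (metis divide_ennreal_def ennreal_divide_self)
    ultimately have "c * a / (c * b) = (c * inverse c) * (a * inverse b)"
      by (simp only: divide_ennreal_def ac_simps)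
    with cc show ?thesis
      by (simp add: divide_ennreal_def)
  qed
  show ?thesis
  proof (rule measure_eqI)
    fix A assume "A \<in> sets (distr (uniform_measure lborel (linf_ball 0 1)) borel ?T)"
    then have A [measurable]: "A \<in> sets borel" by simp
    have TA: "?T -` A \<in> sets borel" using measurable_sets[OF T A] by simp
    have "emeasure (distr (uniform_measure lborel (linf_ball 0 1)) borel ?T) A =
        emeasure lborel (linf_ball 0 1 \<inter> ?T -` A) / emeasure lborel (linf_ball 0 1 :: (real^'d) set)"
      using TA by (simp add: emeasure_distr)
    also have "\<dots> = (?c * emeasure lborel (linf_ball 0 1 \<inter> ?T -` A)) /
        (?c * emeasure lborel (linf_ball 0 1 :: (real^'d) set))"
      using \<nu> by (intro cancel[symmetric]) auto
    also have "\<dots> = emeasure lborel (linf_ball w \<nu> \<inter> A) / emeasure lborel (linf_ball w \<nu>)"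
      using A cl by (simp only: scale[OF cl] scale[OF sets.Int[OF cl A]] vimage_Int pre)
    also have "\<dots> = emeasure (uniform_measure lborel (linf_ball w \<nu>)) A"
      by simp
    finally show "emeasure (distr (uniform_measure lborel (linf_ball 0 1)) borel ?T) A =
        emeasure (uniform_measure lborel (linf_ball w \<nu>)) A" .
  qed simp
qed

text \<open>The random tape of one call of the oracle is a pair \<open>(a, b)\<close> of independent points, each
  uniform in \<open>linf_ball 0 1\<close>. Then \<open>u\<close> is uniform in \<open>linf_ball w \<nu>\<^sub>1\<close> and, given \<open>u\<close>, the
  point \<open>z\<close> is uniform in \<open>linf_ball u \<nu>\<^sub>2\<close>.\<close>

definition opt_tape :: "((real^'d) \<times> (real^'d)) measure" where
  "opt_tape = uniform_measure lborel (linf_ball 0 1) \<Otimes>\<^sub>M uniform_measure lborel (linf_ball 0 1)"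

definition opt_polar ::
    "(real^'d \<Rightarrow> real \<Rightarrow> bool) \<Rightarrow> real \<Rightarrow> real \<Rightarrow> real \<Rightarrow> (real^'d) \<times> (real^'d) \<Rightarrow> real^'d
      \<Rightarrow> real \<times> (real^'d)" where
  "opt_polar mem r R \<delta> tape w =
     (let d = real CARD('d);
          \<epsilon> = r\<^sup>2 * \<delta>^3 / (10^3 * d powr (7/2) * R\<^sup>2);
          \<nu>\<^sub>1 = r * \<delta> / (10 * d);
          \<nu>\<^sub>2 = sqrt (\<epsilon> * \<nu>\<^sub>1 * r / d powr (1/2));
          u = w + \<nu>\<^sub>1 *\<^sub>R fst tape;
          z = u + \<nu>\<^sub>2 *\<^sub>R snd tape;
          s = (\<chi> i. (gau mem r R (set_coord z i (u $ i + \<nu>\<^sub>2)) \<epsilon>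
                   - gau mem r R (set_coord z i (u $ i - \<nu>\<^sub>2)) \<epsilon>) / (2 * \<nu>\<^sub>2))
      in (gau mem r R w \<delta>, s))"

text \<open>An OCO algorithm for linear losses: \<open>update\<close> processes the gradient of the loss of the
  current round, at which the algorithm has played the \<open>predict\<close> of the current state.\<close>

record ('s, 'v) oco_alg =
  start :: 's
  predict :: "'s \<Rightarrow> 'v"
  update :: "'s \<Rightarrow> 'v \<Rightarrow> 's"

text \<open>\<open>prox_sum\<close> is the sum of \<open>\<sigma>\<^sub>s w\<^sub>s\<close> over the completed rounds. For \<open>V = 0\<close>, where the
  learning rate is infinite, HOL division gives \<open>1 / ftrl_eta D 0 = 0\<close>, i.e. the convention that
  the inverse of infinity is 0.\<close>

record 'v ftrl_state =
  grad_sum :: 'v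
  sq_sum :: real
  sigma_sum :: real
  prox_sum :: 'v
  iterate :: 'v

definition ftrl_eta :: "real \<Rightarrow> real \<Rightarrow> real" where
  "ftrl_eta D V = sqrt 2 * D / sqrt V"

definition ftrl_update ::
    "real \<Rightarrow> 'v::euclidean_space ftrl_state \<Rightarrow> 'v \<Rightarrow> 'v ftrl_state" where
  "ftrl_update D st v =
     (let G = grad_sum st + v;
          V = sq_sum st + (norm v)\<^sup>2;
          \<sigma> = 1 / ftrl_eta D V - 1 / ftrl_eta D (sq_sum st);
          Sigma' = sigma_sum st + \<sigma>;
          P = prox_sum st + \<sigma> *\<^sub>R iterate st
      in \<lparr>grad_sum = G, sq_sum = V, sigma_sum = Sigma', prox_sum = P,
          iterate = (if Sigma' = 0 then 0 else closest_point (cball 0 D) ((- G + P) /\<^sub>R Sigma'))\<rparr>)"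

definition ftrl_proximal :: "real \<Rightarrow> ('v::euclidean_space ftrl_state, 'v) oco_alg" where
  "ftrl_proximal D =
     \<lparr>start = \<lparr>grad_sum = 0, sq_sum = 0, sigma_sum = 0, prox_sum = 0, iterate = 0\<rparr>,
      predict = iterate, update = ftrl_update D\<rparr>"

definition wrapper_play :: "real \<times> 'v \<Rightarrow> 'v::real_inner \<Rightarrow> 'v" where
  "wrapper_play = (\<lambda>(\<gamma>, s) w. if \<gamma> \<ge> 1 then w /\<^sub>R \<gamma> else w)"

definition wrapper_grad :: "real \<times> 'v \<Rightarrow> 'v::real_inner \<Rightarrow> 'v \<Rightarrow> 'v" where
  "wrapper_grad = (\<lambda>(\<gamma>, s) w g.
     let \<nu> = (if \<gamma> \<ge> 1 then s else 0); x = wrapper_play (\<gamma>, s) w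
     in g - (if g \<bullet> w < 0 then (g \<bullet> x) *\<^sub>R \<nu> else 0))"

text \<open>\<open>wrapper_state A orc g n\<close> is the state of \<open>A\<close> after rounds 1 to \<open>n\<close>, where \<open>orc t\<close> is the
  realized oracle of round \<open>t\<close> and \<open>g t\<close> the subgradient observed in round \<open>t\<close>. Rounds are
  numbered from 1; index 0 of \<open>orc\<close> and \<open>g\<close> is never used.\<close>

primrec wrapper_state ::
    "('s, 'v::real_inner) oco_alg \<Rightarrow> (nat \<Rightarrow> 'v \<Rightarrow> real \<times> 'v) \<Rightarrow> (nat \<Rightarrow> 'v) \<Rightarrow> nat \<Rightarrow> 's" where
  "wrapper_state A orc g 0 = start A"
| "wrapper_state A orc g (Suc n) =
     (let st = wrapper_state A orc g n; w = predict A st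
      in update A st (wrapper_grad (orc (Suc n) w) w (g (Suc n))))"

definition wrapper_w ::
    "('s, 'v::real_inner) oco_alg \<Rightarrow> (nat \<Rightarrow> 'v \<Rightarrow> real \<times> 'v) \<Rightarrow> (nat \<Rightarrow> 'v) \<Rightarrow> nat \<Rightarrow> 'v" where
  "wrapper_w A orc g t = predict A (wrapper_state A orc g (t - 1))"

definition wrapper_x ::
    "('s, 'v::real_inner) oco_alg \<Rightarrow> (nat \<Rightarrow> 'v \<Rightarrow> real \<times> 'v) \<Rightarrow> (nat \<Rightarrow> 'v) \<Rightarrow> nat \<Rightarrow> 'v" where
  "wrapper_x A orc g t = (let w = wrapper_w A orc g t in wrapper_play (orc t w) w)"

end

theory Submission
  imports Defs
begin

text \<open>
Let \<open>\<gamma>\<close> be the gauge of \<open>C\<close>, so that \<open>C = {x. \<gamma> x \<le> 1}\<close>. It is convex, positively homogeneous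
and \<open>1 / r\<close>-Lipschitz. If the wrapper knew \<open>\<gamma>\<close> and its subgradients exactly, it would play
\<open>x = w / \<gamma> w\<close> whenever \<open>w\<close> lies outside \<open>C\<close>. If \<open>g \<bullet> w < 0\<close>, then with \<open>p\<close> a subgradient
at \<open>w\<close> the surrogate gradient \<open>g - (g \<bullet> x) *\<^sub>R p\<close> would satisfy
\<open>g \<bullet> (x - x') \<le> (g - (g \<bullet> x) *\<^sub>R p) \<bullet> (w - x')\<close> for all \<open>x' \<in> C\<close> and have norm at most
\<open>(1 + \<kappa>) * norm g\<close>; if \<open>g \<bullet> w \<ge> 0\<close>, then \<open>g\<close> itself has both properties. So the regret of
the wrapper would be at most that of FTRL-proximal on the surrogate losses over the ball of radius \<open>R\<close>,
which is \<open>2 * sqrt 2 * R\<close> times the root of the sum of their squared gradient norms (\<open>ftrl_regret\<close>).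

The proof consists in controlling the two approximations. The gauge estimate from bisection, unless it
is 0 at a point well inside \<open>C\<close>, is at least the gauge and exceeds it by at most \<open>\<delta>\<close>
(\<open>gau_correct\<close>); being an upper bound, it keeps the played points in \<open>C\<close>, deterministically. The estimated subgradient is a vector of
central differences around random points. Each coordinate differs from that of a true subgradient \<open>p\<close>
nearby by rounding errors and at most by the slope gap, the difference of the slopes of \<open>\<gamma>\<close> on two
short intervals that flank the evaluated segment (\<open>central_difference_error\<close>,
\<open>opt_polar_near_subgradient\<close>). The slope gap is the difference of one bounded function at two
close positions, so that averaging over a cube that is large compared with their distance leaves only boundary
terms (\<open>cube_measure_shift_le\<close>, \<open>expected_fd_error\<close>). It involves only the gauge, so it is a random
variable even if the answers of the membership oracle, and with them the estimated subgradients, are not measurable.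

These errors enter the regret linearly, multiplied by the largest gradient norm: once in the
comparison of the losses (\<open>surrogate_loss_bound\<close>) and once through the norms of the surrogate gradients
(\<open>wrapper_regret\<close>). Since the iterate of round \<open>t\<close> is determined before the tape of that round is
drawn, the bound on the expected error, which is uniform in \<open>w\<close>, applies in each round
(\<open>nn_integral_independent_le\<close>). The tolerances are summable, so the expected total error is of order
\<open>\<delta> / R\<close>, and Markov's inequality turns this into the term with \<open>\<delta> / \<rho>\<close>. One exceptional event
serves all comparators simultaneously, because the error is a bound on \<open>norm (s - p)\<close> and does not involve \<open>x'\<close>.
\<close>

section \<open>The gauge and the polar body\<close>

definition polar_body :: "'v::real_inner set \<Rightarrow> 'v set" where
  "polar_body C = {a. \<forall>x\<in>C. a \<bullet> x \<le> 1}"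

text \<open>The support function of the polar body. For a closed convex set with \<open>0\<close> in its interior it is
the Minkowski functional. In this form maximisers over the compact polar body exist, and
a maximiser at \<open>x\<close> is a subgradient of the gauge at \<open>x\<close>.\<close>

definition minkowski_gauge :: "'v::real_inner set \<Rightarrow> 'v \<Rightarrow> real" where
  "minkowski_gauge C x = (SUP a\<in>polar_body C. a \<bullet> x)"

locale convex_body =
  fixes C :: "'v::euclidean_space set" and r :: real
  assumes closed_body: "closed C" and convex_body: "convex C"
    and r_pos: "0 < r" and ball_subset: "cball 0 r \<subseteq> C"
begin

abbreviation \<gamma> :: "'v \<Rightarrow> real" where "\<gamma> \<equiv> minkowski_gauge C"

lemma zero_in_body: "0 \<in> C"
  using ball_subset r_pos by auto

lemma norm_polar_le:
  assumes "a \<in> polar_body C"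
  shows "norm a \<le> 1 / r"
proof (cases "a = 0")
  case False
  have "(r / norm a) *\<^sub>R a \<in> C"
    using False r_pos by (intro subsetD[OF ball_subset]) simp
  with assms have "a \<bullet> ((r / norm a) *\<^sub>R a) \<le> 1"
    by (auto simp: polar_body_def)
  then have "r * norm a \<le> 1"
    using False by (simp add: dot_square_norm power2_eq_square)
  then show ?thesis
    using r_pos by (simp add: field_simps)
qed (use r_pos in simp)

lemma polar_inner_le:
  assumes "a \<in> polar_body C"
  shows "a \<bullet> x \<le> norm x / r"
proof -
  have "a \<bullet> x \<le> norm a * norm x"
    by (rule norm_cauchy_schwarz)
  also have "\<dots> \<le> 1 / r * norm x"
    by (intro mult_right_mono norm_polar_le assms) simp
  finally show ?thesis by simp
qed

lemma zero_in_polar: "0 \<in> polar_body C"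
  by (simp add: polar_body_def)

lemma compact_polar: "compact (polar_body C)"
proof -
  have "polar_body C = (\<Inter>x\<in>C. {a. x \<bullet> a \<le> 1})"
    by (auto simp: polar_body_def inner_commute)
  then have "closed (polar_body C)"
    by (simp add: closed_INT closed_halfspace_le)
  moreover have "bounded (polar_body C)"
    using norm_polar_le by (intro boundedI)
  ultimately show ?thesis
    by (simp add: compact_eq_bounded_closed)
qed

lemma polar_inner_le_gauge:
  assumes "a \<in> polar_body C"
  shows "a \<bullet> x \<le> \<gamma> x"
  unfolding minkowski_gauge_def
  using polar_inner_le assms by (intro cSUP_upper) (auto intro!: bdd_aboveI2)

lemma gauge_attained:
  obtains a where "a \<in> polar_body C" "a \<bullet> x = \<gamma> x"
proof -
  have "\<exists>a\<in>polar_body C. \<forall>b\<in>polar_body C. b \<bullet> x \<le> a \<bullet> x"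
    using zero_in_polar
    by (intro continuous_attains_sup compact_polar continuous_intros) auto
  then obtain a where a: "a \<in> polar_body C" "\<And>b. b \<in> polar_body C \<Longrightarrow> b \<bullet> x \<le> a \<bullet> x"
    by auto
  have "\<gamma> x \<le> a \<bullet> x"
    unfolding minkowski_gauge_def using a zero_in_polar by (intro cSUP_least) auto
  with a polar_inner_le_gauge[OF a(1), of x] that show thesis
    by force
qed

lemma gauge_le_norm: "\<gamma> x \<le> norm x / r"
  by (metis gauge_attained polar_inner_le)

lemma gauge_triangle: "\<gamma> (x + y) \<le> \<gamma> x + \<gamma> y"
proof -
  obtain a where "a \<in> polar_body C" "a \<bullet> (x + y) = \<gamma> (x + y)"
    by (rule gauge_attained)
  then show ?thesis
    using polar_inner_le_gauge[of a x] polar_inner_le_gauge[of a y]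
    by (simp add: inner_add_right)
qed

lemma gauge_scale:
  assumes "0 \<le> c"
  shows "\<gamma> (c *\<^sub>R x) = c * \<gamma> x"
proof (rule antisym)
  obtain a where "a \<in> polar_body C" "a \<bullet> (c *\<^sub>R x) = \<gamma> (c *\<^sub>R x)"
    by (rule gauge_attained)
  then show "\<gamma> (c *\<^sub>R x) \<le> c * \<gamma> x"
    using polar_inner_le_gauge[of a x] assms by (metis inner_scaleR_right mult_left_mono)
next
  obtain a where "a \<in> polar_body C" "a \<bullet> x = \<gamma> x"
    by (rule gauge_attained)
  then show "c * \<gamma> x \<le> \<gamma> (c *\<^sub>R x)"
    using polar_inner_le_gauge[of a "c *\<^sub>R x"] by simp
qed

lemma gauge_nonneg: "0 \<le> \<gamma> x"
  using polar_inner_le_gauge[OF zero_in_polar, of x] by simp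

lemma gauge_lipschitz: "\<bar>\<gamma> x - \<gamma> y\<bar> \<le> norm (x - y) / r"
  using gauge_triangle[of "x - y" y] gauge_triangle[of "y - x" x]
    gauge_le_norm[of "x - y"] gauge_le_norm[of "y - x"]
  by (simp add: norm_minus_commute)

lemma continuous_on_gauge: "continuous_on S \<gamma>"
proof (rule continuous_on_subset)
  have "(1 / r)-lipschitz_on UNIV \<gamma>"
    using gauge_lipschitz r_pos by (intro lipschitz_onI) (auto simp: dist_norm)
  then show "continuous_on UNIV \<gamma>"
    by (rule lipschitz_on_continuous_on)
qed simp

text \<open>A point outside the closed convex set \<open>C\<close> is cut off by a hyperplane, and since \<open>0\<close> lies on
the other side, the normal of that hyperplane can be scaled into the polar body.\<close>

lemma mem_body_iff: "x \<in> C \<longleftrightarrow> \<gamma> x \<le> 1"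
proof
  assume x: "x \<in> C"
  obtain a where "a \<in> polar_body C" "a \<bullet> x = \<gamma> x"
    by (rule gauge_attained)
  with x show "\<gamma> x \<le> 1"
    by (auto simp: polar_body_def)
next
  assume le: "\<gamma> x \<le> 1"
  show "x \<in> C"
  proof (rule ccontr)
    assume "x \<notin> C"
    then obtain a b where ab: "a \<bullet> x < b" "\<And>y. y \<in> C \<Longrightarrow> b < a \<bullet> y"
      using separating_hyperplane_closed_point[OF convex_body closed_body] by blast
    have b: "b < 0"
      using ab(2)[OF zero_in_body] by simp
    have "a /\<^sub>R b \<in> polar_body C"
      using ab(2) b by (force simp: polar_body_def field_simps)
    then have "(a /\<^sub>R b) \<bullet> x \<le> 1"
      using polar_inner_le_gauge[of "a /\<^sub>R b" x] le by linarith
    with ab(1) b show False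
      by (simp add: field_simps)
  qed
qed

lemma gauge_le_if_oracle:
  assumes "membership_oracle C mem" "0 < \<epsilon>" "mem x \<epsilon>"
  shows "\<gamma> x \<le> 1 + \<epsilon> / r"
proof -
  have "x \<in> outer_parallel C \<epsilon>"
    using assms by (auto simp: membership_oracle_def)
  then obtain y where y: "y \<in> C" "norm (x - y) \<le> \<epsilon>"
    by (auto simp: outer_parallel_def)
  have "norm (x - y) / r \<le> \<epsilon> / r"
    using y r_pos by (intro divide_right_mono) auto
  then show ?thesis
    using gauge_lipschitz[of x y] y mem_body_iff[of y] by linarith
qed

lemma gauge_gt_if_not_oracle:
  assumes "membership_oracle C mem" "0 < \<epsilon>" "\<not> mem x \<epsilon>"
  shows "1 - \<epsilon> / r < \<gamma> x"
proof -
  have "x \<notin> inner_parallel C \<epsilon>"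
    using assms by (auto simp: membership_oracle_def)
  then obtain y where y: "norm y \<le> \<epsilon>" "x + y \<notin> C"
    by (auto simp: inner_parallel_def)
  have "norm y / r \<le> \<epsilon> / r"
    using y r_pos by (intro divide_right_mono) auto
  then show ?thesis
    using gauge_lipschitz[of x "x + y"] y mem_body_iff[of "x + y"] by simp
qed

end

section \<open>Accuracy of the gauge oracle\<close>

text \<open>The bisection of the algorithm, for an arbitrary answer \<open>Q \<mu>\<close> of the oracle at \<open>\<mu> *\<^sub>R w\<close>.
Monotonicity of \<open>Q\<close> cannot be assumed, as answers near the boundary are arbitrary; what
survives is that the final interval has a rejected upper end and a lower end that is 0 or accepted. Each round
halves the interval, so the number of whole multiples of \<open>\<tau>\<close> in its length decreases.\<close>

lemma bisection_brackets:
  fixes Q :: "real \<Rightarrow> bool"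
  assumes \<tau>: "0 < \<tau>" and "\<not> Q 2"
  obtains \<alpha> \<beta> \<mu> where
    "while (\<lambda>(\<alpha>, \<beta>, \<mu>). \<tau> < \<beta> - \<alpha>)
       (\<lambda>(\<alpha>, \<beta>, \<mu>). let (\<alpha>', \<beta>') = (if Q \<mu> then (\<mu>, \<beta>) else (\<alpha>, \<mu>))
         in (\<alpha>', \<beta>', (\<alpha>' + \<beta>') / 2)) (0, 2, 1) = (\<alpha>, \<beta>, \<mu>)"
    "\<beta> - \<alpha> \<le> \<tau>" "0 \<le> \<alpha>" "\<alpha> \<le> \<beta>" "\<beta> \<le> 2" "\<alpha> = 0 \<or> Q \<alpha>" "\<not> Q \<beta>"
proof -
  let ?B = "\<lambda>(\<alpha>, \<beta>, \<mu>). \<tau> < \<beta> - \<alpha>"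
  let ?c = "\<lambda>(\<alpha>, \<beta>, \<mu>). let (\<alpha>', \<beta>') = (if Q \<mu> then (\<mu>, \<beta>) else (\<alpha>, \<mu>)) in (\<alpha>', \<beta>', (\<alpha>' + \<beta>') / 2)"
  let ?P = "\<lambda>(\<alpha>, \<beta>, \<mu>). \<mu> = (\<alpha> + \<beta>) / 2 \<and> 0 \<le> \<alpha> \<and> \<alpha> \<le> \<beta> \<and> \<beta> \<le> 2 \<and> (\<alpha> = 0 \<or> Q \<alpha>) \<and> \<not> Q \<beta>"
  let ?m = "\<lambda>(\<alpha>, \<beta>, \<mu>::real). nat \<lfloor>(\<beta> - \<alpha>) / \<tau>\<rfloor>"
  define res where "res = while ?B ?c (0, 2, 1)"
  have "?P res \<and> \<not> ?B res"
    unfolding res_def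
  proof (rule while_rule[where P = ?P and r = "Wellfounded.measure ?m"])
    show "?P (0, 2, 1)"
      using assms by auto
  next
    fix s assume "?P s" "?B s"
    then show "?P (?c s)"
      by (cases s) auto
  next
    fix s assume P: "?P s" and B: "?B s"
    obtain a b m where s: "s = (a, b, m)"
      by (cases s)
    have m: "m = (a + b) / 2" and ab: "\<tau> < b - a"
      using P B s by auto
    have halves: "b - m = (b - a) / 2" "m - a = (b - a) / 2"
      using m by (auto simp: field_simps)
    define x where "x = (b - a) / \<tau>"
    have "1 < x"
      using ab \<tau> by (simp add: x_def)
    then have "1 \<le> \<lfloor>x\<rfloor>" "x < real_of_int \<lfloor>x\<rfloor> + 1"
      by simp_all
    then have "x / 2 < real_of_int \<lfloor>x\<rfloor>"
      by linarith
    then have "nat \<lfloor>x / 2\<rfloor> < nat \<lfloor>x\<rfloor>"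
      using \<open>1 \<le> \<lfloor>x\<rfloor>\<close> by (subst nat_less_eq_zless) (auto simp: floor_less_iff x_def)
    moreover have "(b - a) / 2 / \<tau> = x / 2"
      by (simp add: x_def)
    ultimately have "nat \<lfloor>(b - a) / 2 / \<tau>\<rfloor> < nat \<lfloor>(b - a) / \<tau>\<rfloor>"
      by (simp only: x_def)
    then show "(?c s, s) \<in> Wellfounded.measure ?m"
      by (simp add: s halves)
  qed auto
  then show thesis
    by (cases res) (auto intro!: that simp: res_def)
qed

context convex_body
begin

text \<open>The returned inverse is \<open>1 / (\<alpha> - \<tau>)\<close> with \<open>\<alpha>\<close> the accepted end of the bisection.
Acceptance gives \<open>\<alpha> * \<gamma> w \<le> 1 + \<tau> / 2\<close>, rejection at the other end gives
\<open>(\<alpha> + \<tau>) * \<gamma> w \<ge> 1 - \<tau> / 2\<close>; subtracting \<open>\<tau>\<close> before inverting makes the result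
an upper bound of the gauge, which is what keeps the played point inside \<open>C\<close>. The factor
\<open>\<kappa>\<^sup>2\<close> in \<open>\<tau>\<close> pays for \<open>\<gamma> w\<close> and \<open>1 / \<alpha>\<close> both being as large as a multiple of
\<open>\<kappa>\<close>. The answer \<open>0\<close> is given only where the gauge is at most about \<open>1 / 2\<close>.\<close>

lemma gau_correct:
  assumes mem: "membership_oracle C mem" and R: "r \<le> R"
    and \<delta>: "0 < \<delta>" "\<delta> < 1" and w: "norm w \<le> 6 * R / 5"
  shows "(gau mem r R w \<delta> = 0 \<and> \<gamma> w \<le> 1 / 2 + \<delta> / 32) \<or>
    (\<gamma> w \<le> gau mem r R w \<delta> \<and> gau mem r R w \<delta> \<le> \<gamma> w + \<delta>)"
proof -
  define \<kappa> where "\<kappa> = R / r"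
  define \<tau> where "\<tau> = \<delta> / (8 * \<kappa>\<^sup>2)"
  define \<epsilon> where "\<epsilon> = \<delta> * r / (4 * \<kappa>)\<^sup>2"
  have \<kappa>: "1 \<le> \<kappa>"
    using R r_pos by (simp add: \<kappa>_def)
  have \<tau>\<kappa>: "8 * \<tau> * \<kappa>\<^sup>2 = \<delta>"
    using \<kappa> by (simp add: \<tau>_def)
  have \<kappa>2: "\<kappa> \<le> \<kappa>\<^sup>2"
    using \<kappa> by (simp add: power2_eq_square)
  have \<tau>_pos: "0 < \<tau>"
    using \<delta> \<kappa> by (simp add: \<tau>_def)
  have "\<tau> * 1 \<le> \<tau> * \<kappa>"
    using \<kappa> \<tau>_pos by (intro mult_left_mono) auto
  moreover have "\<tau> * \<kappa> \<le> \<tau> * \<kappa>\<^sup>2"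
    using \<kappa>2 \<tau>_pos by (intro mult_left_mono) auto
  ultimately have \<tau>_le: "8 * \<tau> \<le> \<delta>" "8 * (\<tau> * \<kappa>) \<le> \<delta>" "\<tau> \<le> \<tau> * \<kappa>"
    using \<tau>\<kappa> by linarith+
  have \<epsilon>\<tau>: "\<epsilon> / r = \<tau> / 2"
    using r_pos by (simp add: \<epsilon>_def \<tau>_def power2_eq_square)
  have \<epsilon>_pos: "0 < \<epsilon>"
    using \<delta> \<kappa> r_pos by (simp add: \<epsilon>_def)
  have in_gauge: "c * \<gamma> w \<le> 1 + \<tau> / 2" if "mem (c *\<^sub>R w) \<epsilon>" "0 \<le> c" for c
    using gauge_le_if_oracle[OF mem \<epsilon>_pos that(1)] that(2) \<epsilon>\<tau> by (simp add: gauge_scale)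
  have out_gauge: "1 - \<tau> / 2 \<le> c * \<gamma> w" if "\<not> mem (c *\<^sub>R w) \<epsilon>" "0 \<le> c" for c
    using gauge_gt_if_not_oracle[OF mem \<epsilon>_pos that(1)] that(2) \<epsilon>\<tau> by (simp add: gauge_scale)
  have \<gamma>_le: "\<gamma> w \<le> 6 / 5 * \<kappa>"
  proof -
    have "norm w / r \<le> 6 * R / 5 / r"
      using w r_pos by (intro divide_right_mono) auto
    then show ?thesis
      using gauge_le_norm[of w] by (simp add: \<kappa>_def)
  qed
  have gau_eq: "gau mem r R w \<delta> = (if mem (2 *\<^sub>R w) \<epsilon> \<or> norm w \<le> r / 2 then 0
      else let (\<alpha>, \<beta>, \<mu>) = 
        while (\<lambda>(\<alpha>, \<beta>, \<mu>). \<tau> < \<beta> - \<alpha>)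
          (\<lambda>(\<alpha>, \<beta>, \<mu>). let (\<alpha>', \<beta>') = (if mem (\<mu> *\<^sub>R w) \<epsilon> then (\<mu>, \<beta>) else (\<alpha>, \<mu>))
            in (\<alpha>', \<beta>', (\<alpha>' + \<beta>') / 2)) (0, 2, 1)
        in inverse (\<alpha> - \<tau>))"
    unfolding gau_def Let_def \<epsilon>_def \<tau>_def \<kappa>_def by (rule refl)
  show ?thesis
  proof (cases "mem (2 *\<^sub>R w) \<epsilon> \<or> norm w \<le> r / 2")
    case True
    then have "gau mem r R w \<delta> = 0"
      by (auto simp: gau_eq)
    moreover have "\<gamma> w \<le> 1 / 2 + \<tau> / 4"
    proof (cases "mem (2 *\<^sub>R w) \<epsilon>")
      case True
      from in_gauge[OF this] show ?thesis by simp
    next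
      case False
      with True have "norm w / r \<le> 1 / 2"
        using r_pos by (simp add: field_simps)
      then show ?thesis
        using gauge_le_norm[of w] \<tau>_pos by linarith
    qed
    ultimately show ?thesis
      using \<tau>_le by auto
  next
    case False
    obtain \<alpha> \<beta> \<mu> where res: "while (\<lambda>(\<alpha>, \<beta>, \<mu>). \<tau> < \<beta> - \<alpha>)
          (\<lambda>(\<alpha>, \<beta>, \<mu>). let (\<alpha>', \<beta>') = (if mem (\<mu> *\<^sub>R w) \<epsilon> then (\<mu>, \<beta>) else (\<alpha>, \<mu>))
            in (\<alpha>', \<beta>', (\<alpha>' + \<beta>') / 2)) (0, 2, 1) = (\<alpha>, \<beta>, \<mu>)"
      and bracket: "\<beta> - \<alpha> \<le> \<tau>" "0 \<le> \<alpha>" "\<alpha> \<le> \<beta>" "\<beta> \<le> 2"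
        "\<alpha> = 0 \<or> mem (\<alpha> *\<^sub>R w) \<epsilon>" "\<not> mem (\<beta> *\<^sub>R w) \<epsilon>"
      using False by (elim bisection_brackets[OF \<tau>_pos, of "\<lambda>c. mem (c *\<^sub>R w) \<epsilon>", rotated]) auto
    have P: "\<alpha> * \<gamma> w \<le> 1 + \<tau> / 2" "1 - \<tau> / 2 \<le> \<beta> * \<gamma> w"
      using bracket in_gauge[of \<alpha>] out_gauge[of \<beta>] \<tau>_pos by auto
    have gau: "gau mem r R w \<delta> = inverse (\<alpha> - \<tau>)"
      unfolding gau_eq res using False by simp
    have "0 \<le> \<beta>"
      using bracket by linarith
    then have "1 - \<tau> / 2 \<le> \<beta> * (6 / 5 * \<kappa>)"
      using P(2) \<gamma>_le by (meson mult_left_mono order_trans)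
    then have "1 / 2 \<le> (\<beta> - 2 * \<tau>) * \<kappa>"
      using \<tau>_le \<delta> by (simp add: algebra_simps)
    also have "\<dots> \<le> (\<alpha> - \<tau>) * \<kappa>"
      using bracket \<kappa> by (intro mult_right_mono) auto
    finally have \<alpha>\<kappa>: "1 / 2 \<le> (\<alpha> - \<tau>) * \<kappa>" .
    then have \<alpha>_pos: "0 < \<alpha> - \<tau>"
      using \<kappa> zero_less_mult_pos2[of "\<alpha> - \<tau>" \<kappa>] by linarith
    \<comment> \<open>Where the gauge is below \<open>1 / 2\<close>, the bound \<open>\<alpha> \<le> 2\<close> takes over from acceptance.\<close>
    have lower: "(\<alpha> - \<tau>) * \<gamma> w \<le> 1"
    proof (cases "\<gamma> w \<le> 1 / 2")
      case True
      have "(\<alpha> - \<tau>) * \<gamma> w \<le> 2 * (1 / 2)"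
        using True \<alpha>_pos bracket \<tau>_pos gauge_nonneg[of w] by (intro mult_mono) auto
      then show ?thesis by simp
    next
      case False
      then have "\<tau> * (1 / 2) \<le> \<tau> * \<gamma> w"
        using \<tau>_pos by (intro mult_left_mono) auto
      with P(1) show ?thesis
        by (simp add: algebra_simps)
    qed
    have "(\<beta> - \<tau>) * \<gamma> w \<le> \<alpha> * \<gamma> w"
      using bracket gauge_nonneg[of w] by (intro mult_right_mono) auto
    then have "1 - (\<alpha> - \<tau>) * \<gamma> w \<le> \<tau> / 2 + 2 * (\<tau> * \<gamma> w)"
      using P(2) by (simp add: algebra_simps)
    also have "\<dots> \<le> 3 * (\<tau> * \<kappa>)"
    proof -
      have "\<tau> * \<gamma> w \<le> 6 / 5 * (\<tau> * \<kappa>)"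
        using mult_left_mono[OF \<gamma>_le, of \<tau>] \<tau>_pos by (simp add: mult_ac)
      then show ?thesis
        using \<tau>_le \<tau>_pos by linarith
    qed
    also have "\<dots> \<le> (8 * \<tau> * \<kappa>) * ((\<alpha> - \<tau>) * \<kappa>)"
    proof -
      have "(8 * \<tau> * \<kappa>) * (1 / 2) \<le> (8 * \<tau> * \<kappa>) * ((\<alpha> - \<tau>) * \<kappa>)"
        using \<alpha>\<kappa> \<tau>_pos \<kappa> by (intro mult_left_mono) auto
      moreover have "0 \<le> \<tau> * \<kappa>"
        using \<tau>_pos \<kappa> by simp
      ultimately show ?thesis by linarith
    qed
    also have "\<dots> = \<delta> * (\<alpha> - \<tau>)"
      unfolding \<tau>\<kappa>[symmetric] by (simp add: power2_eq_square)
    finally have upper: "1 \<le> (\<gamma> w + \<delta>) * (\<alpha> - \<tau>)"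
      by (simp add: algebra_simps)
    show ?thesis
      using lower upper \<alpha>_pos by (simp add: gau field_simps)
  qed
qed

end

section \<open>Central differences of the gauge\<close>

context convex_body
begin

text \<open>The increase of the slope of the gauge between the two intervals of length \<open>\<nu>\<close> that flank the
segment from \<open>y - \<nu> *\<^sub>R e\<close> to \<open>y + \<nu> *\<^sub>R e\<close>. By convexity, all slopes on the segment, hence
both the central difference quotient and the component along \<open>e\<close> of any subgradient at a point
of the segment, lie between the two flanking slopes. Being continuous in \<open>y\<close>, this bound needs no differentiability of the
gauge and no measurable choice of subgradients.\<close>

definition slope_gap :: "real \<Rightarrow> 'v \<Rightarrow> 'v \<Rightarrow> real" where
  "slope_gap \<nu> e y = ((\<gamma> (y + (2 * \<nu>) *\<^sub>R e) - \<gamma> (y + \<nu> *\<^sub>R e))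
     - (\<gamma> (y - \<nu> *\<^sub>R e) - \<gamma> (y - (2 * \<nu>) *\<^sub>R e))) / \<nu>"

text \<open>The upper half of the comparison; the lower half is the same statement for \<open>- e\<close>. A subgradient
\<open>q\<close> at the end \<open>y + \<nu> *\<^sub>R e\<close> separates the slopes inside from the flanking slope, by
monotonicity of subgradients along the line.\<close>

lemma slope_le_outer_slope:
  assumes \<nu>: "0 < \<nu>" and z: "z = y + l *\<^sub>R e" "l \<le> \<nu>" and p: "p \<in> polar_body C" "p \<bullet> z = \<gamma> z"
  shows "\<nu> * (p \<bullet> e) \<le> \<gamma> (y + (2 * \<nu>) *\<^sub>R e) - \<gamma> (y + \<nu> *\<^sub>R e)"
    and "\<gamma> (y + \<nu> *\<^sub>R e) - \<gamma> (y - \<nu> *\<^sub>R e) \<le> 2 * (\<gamma> (y + (2 * \<nu>) *\<^sub>R e) - \<gamma> (y + \<nu> *\<^sub>R e))"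
proof -
  obtain q where q: "q \<in> polar_body C" "q \<bullet> (y + \<nu> *\<^sub>R e) = \<gamma> (y + \<nu> *\<^sub>R e)"
    by (rule gauge_attained)
  have outer: "\<nu> * (q \<bullet> e) \<le> \<gamma> (y + (2 * \<nu>) *\<^sub>R e) - \<gamma> (y + \<nu> *\<^sub>R e)"
    using polar_inner_le_gauge[OF q(1), of "y + (2 * \<nu>) *\<^sub>R e"] q(2)
    by (simp add: inner_add_right)
  show "\<gamma> (y + \<nu> *\<^sub>R e) - \<gamma> (y - \<nu> *\<^sub>R e) \<le> 2 * (\<gamma> (y + (2 * \<nu>) *\<^sub>R e) - \<gamma> (y + \<nu> *\<^sub>R e))"
    using polar_inner_le_gauge[OF q(1), of "y - \<nu> *\<^sub>R e"] q(2) outer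
    by (simp add: inner_add_right inner_diff_right)
  show "\<nu> * (p \<bullet> e) \<le> \<gamma> (y + (2 * \<nu>) *\<^sub>R e) - \<gamma> (y + \<nu> *\<^sub>R e)"
  proof (cases "l = \<nu>")
    case True
    then show ?thesis
      using polar_inner_le_gauge[OF p(1), of "y + (2 * \<nu>) *\<^sub>R e"] p(2) z
      by (simp add: inner_add_right)
  next
    case False
    have "(\<nu> - l) * (p \<bullet> e) \<le> (\<nu> - l) * (q \<bullet> e)"
      using polar_inner_le_gauge[OF p(1), of "y + \<nu> *\<^sub>R e"] polar_inner_le_gauge[OF q(1), of z] p(2) q(2)
      unfolding z by (simp add: inner_add_right algebra_simps)
    then have "p \<bullet> e \<le> q \<bullet> e"
      using False z by simp
    then have "\<nu> * (p \<bullet> e) \<le> \<nu> * (q \<bullet> e)"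
      using \<nu> by (intro mult_left_mono) auto
    with outer show ?thesis
      by linarith
  qed
qed

lemma central_difference_error:
  assumes \<nu>: "0 < \<nu>" and z: "z = y + l *\<^sub>R e" "\<bar>l\<bar> \<le> \<nu>" and p: "p \<in> polar_body C" "p \<bullet> z = \<gamma> z"
  shows "\<bar>(\<gamma> (y + \<nu> *\<^sub>R e) - \<gamma> (y - \<nu> *\<^sub>R e)) / (2 * \<nu>) - p \<bullet> e\<bar> \<le> slope_gap \<nu> e y"
proof -
  have "z = y + (- l) *\<^sub>R (- e)" "- l \<le> \<nu>" "l \<le> \<nu>"
    using z by auto
  note lo = slope_le_outer_slope[OF \<nu> this(1,2) p] and up = slope_le_outer_slope[OF \<nu> z(1) this(3) p]
  have "\<bar>(\<gamma> (y + \<nu> *\<^sub>R e) - \<gamma> (y - \<nu> *\<^sub>R e)) - 2 * (\<nu> * (p \<bullet> e))\<bar> / (2 * \<nu>)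
      \<le> 2 * (\<gamma> (y + (2 * \<nu>) *\<^sub>R e) - \<gamma> (y + \<nu> *\<^sub>R e) - (\<gamma> (y - \<nu> *\<^sub>R e) - \<gamma> (y - (2 * \<nu>) *\<^sub>R e))) / (2 * \<nu>)"
    using up lo \<nu> by (intro divide_right_mono) (auto simp: abs_le_iff)
  also have "\<dots> = slope_gap \<nu> e y"
    unfolding slope_gap_def using \<nu> by (subst mult_divide_mult_cancel_left) auto
  also have "\<bar>(\<gamma> (y + \<nu> *\<^sub>R e) - \<gamma> (y - \<nu> *\<^sub>R e)) - 2 * (\<nu> * (p \<bullet> e))\<bar> / (2 * \<nu>) =
      \<bar>(\<gamma> (y + \<nu> *\<^sub>R e) - \<gamma> (y - \<nu> *\<^sub>R e)) / (2 * \<nu>) - p \<bullet> e\<bar>"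
  proof -
    have "x / (2 * \<nu>) - c = (x - 2 * (\<nu> * c)) / (2 * \<nu>)" for x c
      using \<nu> by (simp add: field_simps)
    then show ?thesis
      using \<nu> by (simp add: abs_divide)
  qed
  finally show ?thesis .
qed

lemma slope_gap_nonneg:
  assumes "0 < \<nu>"
  shows "0 \<le> slope_gap \<nu> e y"
proof -
  obtain p where "p \<in> polar_body C" "p \<bullet> y = \<gamma> y"
    by (rule gauge_attained)
  then have "\<bar>(\<gamma> (y + \<nu> *\<^sub>R e) - \<gamma> (y - \<nu> *\<^sub>R e)) / (2 * \<nu>) - p \<bullet> e\<bar> \<le> slope_gap \<nu> e y"
    using assms by (intro central_difference_error[where l = 0 and z = y]) auto
  then show ?thesis by linarith
qed

end

section \<open>Accuracy of the subgradient oracle\<close>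

text \<open>The dimension is a parameter \<open>d\<close>, because the step sizes below depend on it but on no object whose
type mentions the dimension.\<close>

locale polar_oracle = convex_body C r
  for C :: "(real^'d) set" and r :: real +
  fixes R :: real and mem :: "real^'d \<Rightarrow> real \<Rightarrow> bool" and d :: real
  assumes r_le_R: "r \<le> R" and body_bounded: "C \<subseteq> cball 0 R"
    and mem_correct: "membership_oracle C mem"
    and d_eq: "d = real CARD('d)"
begin

definition fd_tol :: "real \<Rightarrow> real" where
  "fd_tol \<delta> = r\<^sup>2 * \<delta>^3 / (10^3 * d powr (7/2) * R\<^sup>2)"

definition smoothing :: "real \<Rightarrow> real" where
  "smoothing \<delta> = r * \<delta> / (10 * d)"

definition fd_step :: "real \<Rightarrow> real" where
  "fd_step \<delta> = sqrt (fd_tol \<delta> * smoothing \<delta> * r / d powr (1/2))"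

lemma R_pos: "0 < R"
  using r_pos r_le_R by linarith

lemma d_ge_1: "1 \<le> d" "1 \<le> sqrt d"
  using finite_UNIV_card_ge_0[where 'a = 'd] by (auto simp: d_eq)

lemma fd_tol_eq: "fd_tol \<delta> = r\<^sup>2 * \<delta>^3 / (1000 * d^3 * sqrt d * R\<^sup>2)"
proof -
  have "d powr (7/2) = d powr (3 + 1/2)"
    by simp
  also have "\<dots> = d powr 3 * d powr (1/2)"
    by (rule powr_add)
  also have "\<dots> = d^3 * sqrt d"
    using d_ge_1 by (simp add: powr_half_sqrt)
  finally show ?thesis
    by (simp add: fd_tol_def mult.assoc)
qed

lemma fd_step_eq:
  assumes "0 < \<delta>"
  shows "fd_step \<delta> = r\<^sup>2 * \<delta>\<^sup>2 / (100 * d\<^sup>2 * sqrt d * R)"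
proof -
  have "fd_tol \<delta> * smoothing \<delta> * r / sqrt d = (r\<^sup>2 * \<delta>\<^sup>2 / (100 * d\<^sup>2 * sqrt d * R))\<^sup>2"
    by (simp add: fd_tol_eq smoothing_def power_divide power_mult_distrib)
       (simp add: power_def numeral_eq_Suc field_simps)
  then show ?thesis
    using assms r_pos R_pos d_ge_1 unfolding fd_step_def
    by (simp add: powr_half_sqrt)
qed

text \<open>What the choice of the step sizes achieves: rounding errors of order \<open>\<delta> / R\<close>, evaluation points
close to \<open>w\<close>, and a finite difference step so much smaller than the smoothing radius that the
expected slope gap is of order \<open>\<delta> / R\<close> as well.\<close>

lemma parameters:
  assumes \<delta>: "0 < \<delta>" "\<delta> < 1/3"
  shows "0 < smoothing \<delta>" "0 < fd_step \<delta>" "0 < fd_tol \<delta>" "fd_tol \<delta> < 1/3"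
    "d * (fd_tol \<delta> / (2 * fd_step \<delta>)) = \<delta> / (20 * R)"
    "sqrt d * (smoothing \<delta> + fd_step \<delta>) \<le> r * \<delta> / 8"
    "d * (3 * fd_step \<delta> / (r * smoothing \<delta>)) \<le> 3 * \<delta> / (10 * R)"
proof -
  define q where "q = sqrt d"
  have q: "1 \<le> q" "d = q * q"
    using d_ge_1 by (auto simp: q_def)
  have step: "fd_step \<delta> = smoothing \<delta> * (\<delta> * r / (10 * R * d * q))"
    unfolding fd_step_eq[OF \<delta>(1)] smoothing_def q_def[symmetric] using q
    by (simp add: power2_eq_square field_simps)
  show pos: "0 < smoothing \<delta>" "0 < fd_step \<delta>" "0 < fd_tol \<delta>"
    using \<delta> r_pos R_pos d_ge_1 by (auto simp: smoothing_def fd_step_eq fd_tol_eq)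
  show "d * (fd_tol \<delta> / (2 * fd_step \<delta>)) = \<delta> / (20 * R)"
    unfolding fd_step_eq[OF \<delta>(1)] fd_tol_eq q_def[symmetric] using q \<delta> r_pos R_pos
    by (simp add: power2_eq_square power3_eq_cube field_simps)
  have ratio: "r / R \<le> 1"
    using r_le_R R_pos by simp
  have dq: "1 \<le> d * q" "q \<le> d"
    using q mult_mono[of 1 q 1 q] mult_mono[of 1 d 1 q] mult_left_mono[of 1 q q] by auto
  have inv: "1 / (d * q) \<le> 1"
    using dq by simp
  have "\<delta> * r / (10 * R * d * q) = \<delta> / 10 * ((r / R) * (1 / (d * q)))"
    by simp
  also have "\<dots> \<le> \<delta> / 10 * (1 * 1)"
    using \<delta> ratio inv r_pos R_pos dq by (intro mult_left_mono mult_mono) auto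
  finally have factor: "\<delta> * r / (10 * R * d * q) \<le> 1 / 30"
    using \<delta> by simp
  have "fd_step \<delta> \<le> smoothing \<delta> / 30"
    using mult_left_mono[OF factor, of "smoothing \<delta>"] pos step by simp
  then have "q * (smoothing \<delta> + fd_step \<delta>) \<le> q * (31 / 30 * smoothing \<delta>)"
    using q by (intro mult_left_mono) auto
  also have "\<dots> = 31 / 300 * (r * \<delta>) * (1 / q)"
    unfolding smoothing_def using q by (simp add: field_simps)
  also have "\<dots> \<le> 31 / 300 * (r * \<delta>) * 1"
    using q \<delta> r_pos by (intro mult_left_mono) auto
  also have "\<dots> \<le> r * \<delta> / 8"
    using \<delta> r_pos by simp
  finally show "sqrt d * (smoothing \<delta> + fd_step \<delta>) \<le> r * \<delta> / 8"
    by (simp add: q_def)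
  have "d * (3 * fd_step \<delta> / (r * smoothing \<delta>)) = 3 * \<delta> / (10 * R) * (1 / q)"
    unfolding step using pos(1) r_pos q by (simp add: field_simps)
  also have "\<dots> \<le> 3 * \<delta> / (10 * R) * 1"
    using q \<delta> R_pos by (intro mult_left_mono) auto
  finally show "d * (3 * fd_step \<delta> / (r * smoothing \<delta>)) \<le> 3 * \<delta> / (10 * R)"
    by simp
  have "fd_tol \<delta> = \<delta>^3 * (1 / 1000 * ((r / R)\<^sup>2 * (1 / d ^ 3 * (1 / q))))"
    by (simp add: fd_tol_eq q_def power_divide mult_ac)
  also have "\<dots> \<le> \<delta>^3 * (1 * (1 * (1 * 1)))"
    using \<delta> ratio r_pos R_pos q d_ge_1
    by (intro mult_mono) (auto intro!: power_le_one)
  also have "\<dots> \<le> \<delta> * 1"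
    using \<delta> power_decreasing[of 1 3 \<delta>] by simp
  finally show "fd_tol \<delta> < 1/3"
    using \<delta> by simp
qed

lemma opt_polar_eq:
  "opt_polar mem r R \<delta> tape w =
    (let u = w + smoothing \<delta> *\<^sub>R fst tape; z = u + fd_step \<delta> *\<^sub>R snd tape
     in (gau mem r R w \<delta>,
       \<chi> i. (gau mem r R (set_coord z i (u $ i + fd_step \<delta>)) (fd_tol \<delta>)
           - gau mem r R (set_coord z i (u $ i - fd_step \<delta>)) (fd_tol \<delta>)) / (2 * fd_step \<delta>)))"
  unfolding opt_polar_def d_eq[symmetric] fd_step_def smoothing_def fd_tol_def Let_def ..

text \<open>The centre of the segment in direction \<open>i\<close> whose end points are evaluated: coordinate \<open>i\<close>
has the value it has in \<open>u\<close>, the others those they have in \<open>z\<close>. Hence a shift of coordinate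
\<open>i\<close> of the first tape moves the whole segment along itself.\<close>

definition segment_centre :: "real \<Rightarrow> (real^'d) \<times> (real^'d) \<Rightarrow> real^'d \<Rightarrow> 'd \<Rightarrow> real^'d" where
  "segment_centre \<delta> tape w i = (\<chi> j. w $ j + smoothing \<delta> * fst tape $ j
     + (if j = i then 0 else fd_step \<delta> * snd tape $ j))"

definition fd_error :: "real \<Rightarrow> (real^'d) \<times> (real^'d) \<Rightarrow> real^'d \<Rightarrow> real" where
  "fd_error \<delta> tape w = (\<Sum>i\<in>UNIV. slope_gap (fd_step \<delta>) (axis i 1) (segment_centre \<delta> tape w i))"

lemma fd_error_nonneg:
  assumes "0 < \<delta>" "\<delta> < 1/3"
  shows "0 \<le> fd_error \<delta> tape w"
  unfolding fd_error_def using parameters[OF assms] by (intro sum_nonneg slope_gap_nonneg) auto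

lemma gau_correct_above:
  assumes "0 < \<delta>" "\<delta> < 1/3" "norm w \<le> 6 * R / 5" "1 / 2 + \<delta> / 32 < \<gamma> w"
  shows "\<gamma> w \<le> gau mem r R w \<delta> \<and> gau mem r R w \<delta> \<le> \<gamma> w + \<delta>"
  using gau_correct[OF mem_correct r_le_R, of \<delta> w] assms by auto

lemma norm_le_componentwise_cart:
  fixes x :: "real^'d"
  assumes "\<And>j. \<bar>x $ j\<bar> \<le> c"
  shows "norm x \<le> sqrt d * c"
proof -
  have c: "0 \<le> c"
    using assms[of undefined] by linarith
  have "(\<Sum>j\<in>UNIV. (norm (x $ j))\<^sup>2) \<le> (\<Sum>j\<in>(UNIV :: 'd set). c\<^sup>2)"
    using assms by (intro sum_mono power_mono) auto
  then have "norm x \<le> sqrt (d * c\<^sup>2)"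
    by (simp add: norm_vec_def L2_set_def d_eq)
  then show ?thesis
    using c by (simp add: real_sqrt_mult)
qed

text \<open>Take for \<open>p\<close> a subgradient of the gauge at the random point \<open>z\<close>. All evaluation points lie
within \<open>r * \<delta> / 8\<close> of \<open>w\<close>, where the Lipschitz constant \<open>1 / r\<close> of the gauge keeps
it above \<open>1 / 2\<close>, so each evaluation of the gauge is accurate to \<open>fd_tol \<delta>\<close>. The error of a
coordinate splits into these rounding errors, divided by the length of the segment, and the
difference between the exact central difference and \<open>p\<close>. Moving the base point of the subgradient
inequality from \<open>z\<close> to \<open>w\<close> costs \<open>2 * norm (z - w) / r\<close>.\<close>

lemma opt_polar_near_subgradient:
  assumes \<delta>: "0 < \<delta>" "\<delta> < 1/3" and w: "norm w \<le> R"
    and tape: "fst tape \<in> linf_ball 0 1" "snd tape \<in> linf_ball 0 1"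
    and ge_1: "1 \<le> fst (opt_polar mem r R \<delta> tape w)"
  obtains p where "p \<in> polar_body C" "\<gamma> w - \<delta> / 4 \<le> p \<bullet> w"
    "norm (snd (opt_polar mem r R \<delta> tape w) - p) \<le> fd_error \<delta> tape w + \<delta> / (20 * R)"
proof -
  define \<nu>\<^sub>1 where "\<nu>\<^sub>1 = smoothing \<delta>"
  define \<nu> where "\<nu> = fd_step \<delta>"
  define \<epsilon> where "\<epsilon> = fd_tol \<delta>"
  define u where "u = w + \<nu>\<^sub>1 *\<^sub>R fst tape"
  define z where "z = u + \<nu> *\<^sub>R snd tape"
  define y where "y i = segment_centre \<delta> tape w i" for i
  note par = parameters[OF \<delta>, folded \<nu>\<^sub>1_def \<nu>_def \<epsilon>_def]
  have a: "\<bar>fst tape $ j\<bar> \<le> 1" and b: "\<bar>snd tape $ j\<bar> \<le> 1" for j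
    using tape by (auto simp: linf_ball_def)
  have a': "\<bar>\<nu>\<^sub>1 * fst tape $ j\<bar> \<le> \<nu>\<^sub>1" and b': "\<bar>\<nu> * snd tape $ j\<bar> \<le> \<nu>" for j
    using mult_left_mono[OF a, of \<nu>\<^sub>1] mult_left_mono[OF b, of \<nu>] par by (auto simp: abs_mult)
  have near: "norm (v - w) \<le> r * \<delta> / 8"
    if "\<And>j. \<exists>c. \<bar>c\<bar> \<le> \<nu> \<and> v $ j = w $ j + \<nu>\<^sub>1 * fst tape $ j + c" for v
  proof -
    have "\<bar>(v - w) $ j\<bar> \<le> \<nu>\<^sub>1 + \<nu>" for j
      using that[of j] a'[of j] by auto
    then have "norm (v - w) \<le> sqrt d * (\<nu>\<^sub>1 + \<nu>)"
      by (rule norm_le_componentwise_cart)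
    with par show ?thesis by linarith
  qed
  have gauge_near: "\<bar>\<gamma> v - \<gamma> w\<bar> \<le> \<delta> / 8" if "norm (v - w) \<le> r * \<delta> / 8" for v
  proof -
    have "norm (v - w) / r \<le> \<delta> / 8"
      using that r_pos by (simp add: field_simps)
    with gauge_lipschitz[of v w] show ?thesis by linarith
  qed
  have \<gamma>w: "2 / 3 < \<gamma> w"
    using gau_correct[OF mem_correct r_le_R, of \<delta> w] \<delta> w R_pos ge_1
    by (auto simp: opt_polar_eq Let_def)
  have endpoint: "\<gamma> v \<le> gau mem r R v \<epsilon> \<and> gau mem r R v \<epsilon> \<le> \<gamma> v + \<epsilon>"
    if "norm (v - w) \<le> r * \<delta> / 8" for v
  proof (rule gau_correct_above)
    show "0 < \<epsilon>" "\<epsilon> < 1/3"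
      using par by auto
    have "r * \<delta> \<le> R * 1"
      using r_le_R \<delta> r_pos by (intro mult_mono) auto
    then show "norm v \<le> 6 * R / 5"
      using norm_triangle_ineq2[of v w] that w R_pos by linarith
    show "1 / 2 + \<epsilon> / 32 < \<gamma> v"
      using gauge_near[OF that] \<gamma>w par \<delta> by linarith
  qed
  obtain p where p: "p \<in> polar_body C" "p \<bullet> z = \<gamma> z"
    by (rule gauge_attained)
  show thesis
  proof (rule that[of p])
    show "p \<in> polar_body C" by (rule p)
    have zw: "norm (z - w) \<le> r * \<delta> / 8"
      using b' by (intro near) (auto simp: z_def u_def)
    have "p \<bullet> (z - w) \<le> norm (z - w) / r"
      using p by (intro polar_inner_le)
    also have "\<dots> \<le> \<delta> / 8"
      using zw r_pos by (simp add: field_simps)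
    finally show "\<gamma> w - \<delta> / 4 \<le> p \<bullet> w"
      using gauge_near[OF zw] p(2) unfolding inner_diff_right by linarith
    let ?s = "snd (opt_polar mem r R \<delta> tape w)"
    have comp: "\<bar>(?s - p) $ i\<bar> \<le> slope_gap \<nu> (axis i 1) (y i) + \<epsilon> / (2 * \<nu>)" for i
    proof -
      have set_coord_eq: "set_coord z i (u $ i + c) = y i + c *\<^sub>R axis i 1" for c
        by (auto simp: set_coord_def y_def segment_centre_def z_def u_def vec_eq_iff axis_def \<nu>_def \<nu>\<^sub>1_def)
      define v v' where "v = y i - \<nu> *\<^sub>R axis i 1" and "v' = y i + \<nu> *\<^sub>R axis i 1"
      have s: "?s $ i = (gau mem r R v' \<epsilon> - gau mem r R v \<epsilon>) / (2 * \<nu>)"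
        using set_coord_eq[of \<nu>] set_coord_eq[of "- \<nu>"]
        by (simp add: opt_polar_eq Let_def u_def[symmetric] z_def[symmetric] v_def v'_def
            \<nu>_def[symmetric] \<nu>\<^sub>1_def[symmetric] \<epsilon>_def[symmetric])
      have "norm (v - w) \<le> r * \<delta> / 8"
      proof (intro near)
        show "\<exists>c. \<bar>c\<bar> \<le> \<nu> \<and> v $ j = w $ j + \<nu>\<^sub>1 * fst tape $ j + c" for j
          using b'[of j] par
          by (intro exI[of _ "if j = i then - \<nu> else \<nu> * snd tape $ j"])
             (auto simp: v_def y_def segment_centre_def axis_def \<nu>_def \<nu>\<^sub>1_def)
      qed
      moreover have "norm (v' - w) \<le> r * \<delta> / 8"
      proof (intro near)
        show "\<exists>c. \<bar>c\<bar> \<le> \<nu> \<and> v' $ j = w $ j + \<nu>\<^sub>1 * fst tape $ j + c" for j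
          using b'[of j] par
          by (intro exI[of _ "if j = i then \<nu> else \<nu> * snd tape $ j"])
             (auto simp: v'_def y_def segment_centre_def axis_def \<nu>_def \<nu>\<^sub>1_def)
      qed
      ultimately have "\<bar>(gau mem r R v' \<epsilon> - gau mem r R v \<epsilon>) - (\<gamma> v' - \<gamma> v)\<bar> \<le> \<epsilon>"
        using endpoint[of v] endpoint[of v'] by auto
      then have "\<bar>(gau mem r R v' \<epsilon> - gau mem r R v \<epsilon>) - (\<gamma> v' - \<gamma> v)\<bar> / (2 * \<nu>) \<le> \<epsilon> / (2 * \<nu>)"
        using par by (intro divide_right_mono) auto
      also have "\<bar>(gau mem r R v' \<epsilon> - gau mem r R v \<epsilon>) - (\<gamma> v' - \<gamma> v)\<bar> / (2 * \<nu>)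
          = \<bar>?s $ i - (\<gamma> v' - \<gamma> v) / (2 * \<nu>)\<bar>"
      proof -
        have "\<bar>A - B\<bar> / (2 * \<nu>) = \<bar>A / (2 * \<nu>) - B / (2 * \<nu>)\<bar>" for A B
          using par by (simp add: diff_divide_distrib[symmetric] abs_divide)
        then show ?thesis
          by (simp only: s)
      qed
      finally have rounding: "\<bar>?s $ i - (\<gamma> v' - \<gamma> v) / (2 * \<nu>)\<bar> \<le> \<epsilon> / (2 * \<nu>)" .
      have "z = y i + (\<nu> * snd tape $ i) *\<^sub>R axis i 1"
        by (auto simp: y_def segment_centre_def z_def u_def vec_eq_iff axis_def \<nu>_def \<nu>\<^sub>1_def)
      from central_difference_error[OF par(2) this b' p]
      have "\<bar>(\<gamma> v' - \<gamma> v) / (2 * \<nu>) - p $ i\<bar> \<le> slope_gap \<nu> (axis i 1) (y i)"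
        by (simp add: v_def v'_def inner_axis)
      with rounding show ?thesis
        unfolding vector_minus_component by linarith
    qed
    have "norm (?s - p) \<le> (\<Sum>i\<in>UNIV. \<bar>(?s - p) $ i\<bar>)"
      by (rule norm_le_l1_cart)
    also have "\<dots> \<le> (\<Sum>i\<in>UNIV. slope_gap \<nu> (axis i 1) (y i) + \<epsilon> / (2 * \<nu>))"
      by (intro sum_mono comp)
    also have "\<dots> = fd_error \<delta> tape w + d * (\<epsilon> / (2 * \<nu>))"
      unfolding fd_error_def \<nu>_def y_def sum.distrib by (simp add: d_eq[symmetric])
    finally show "norm (?s - p) \<le> fd_error \<delta> tape w + \<delta> / (20 * R)"
      using par by simp
  qed
qed

end

section \<open>Expected error of the central differences\<close>

abbreviation cube_measure :: "(real^'d) measure" where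
  "cube_measure \<equiv> uniform_measure lborel (linf_ball 0 1)"

lemma linf_ball_eq_cbox: "linf_ball u \<nu> = cbox (\<chi> j. u $ j - \<nu>) (\<chi> j. u $ j + \<nu>)"
proof -
  have "\<bar>z - c\<bar> \<le> \<nu> \<longleftrightarrow> c - \<nu> \<le> z \<and> z \<le> c + \<nu>" for z c :: real
    by auto
  then show ?thesis
    by (simp add: set_eq_iff linf_ball_def mem_box_cart)
qed

lemma emeasure_unit_cube: "emeasure lborel (linf_ball 0 1 :: (real^'d) set) = ennreal (2 ^ CARD('d))"
proof -
  have ne: "cbox (\<chi> j. - 1) (\<chi> j. 1) \<noteq> ({} :: (real^'d) set)"
    by (simp add: interval_ne_empty_cart)
  have "measure lborel (cbox (\<chi> j. - 1) (\<chi> j. 1) :: (real^'d) set) = 2 ^ CARD('d)"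
    by (subst content_cbox_cart[OF ne]) simp
  then show ?thesis
    by (subst emeasure_eq_ennreal_measure)
       (use emeasure_lborel_cbox_finite in \<open>auto simp: linf_ball_eq_cbox less_top[symmetric]\<close>)
qed

lemma prob_space_cube_measure: "prob_space (cube_measure :: (real^'d) measure)"
  by (rule prob_space_uniform_measure) (simp_all add: emeasure_unit_cube)

text \<open>A shift by \<open>k\<close> moves out of the cube \<open>[-1, 1]\<^sup>d\<close> only a slab of thickness \<open>k\<close>, which is a
fraction \<open>k / 2\<close> of the volume; on the rest the two integrals agree.\<close>

lemma cube_measure_shift_le:
  fixes H :: "real^'d \<Rightarrow> real"
  assumes k: "0 \<le> k" and H [measurable]: "H \<in> borel_measurable borel" and c: "\<And>x. H x \<le> c" "0 \<le> c"
  shows "(\<integral>\<^sup>+a. ennreal (H (a + k *\<^sub>R axis i 1)) \<partial>cube_measure)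
    \<le> (\<integral>\<^sup>+a. ennreal (H a) \<partial>cube_measure) + ennreal (c * k / 2)"
proof -
  let ?Q = "linf_ball 0 1 :: (real^'d) set"
  let ?e = "k *\<^sub>R axis i 1 :: real^'d"
  define lo :: "real^'d" where "lo = (\<chi> j. if j = i then 1 else - 1)"
  define hi :: "real^'d" where "hi = (\<chi> j. if j = i then 1 + k else 1)"
  let ?E = "cbox lo hi"
  have Q [measurable]: "?Q \<in> sets borel"
    by (simp add: linf_ball_eq_cbox)
  have E: "emeasure lborel ?E = ennreal (k / 2) * emeasure lborel ?Q"
  proof -
    have ne: "?E \<noteq> {}"
      using k by (auto simp: interval_ne_empty_cart lo_def hi_def)
    have "measure lborel ?E = (\<Prod>j\<in>UNIV. if j = i then k else 2)"
      unfolding content_cbox_cart[OF ne] by (intro prod.cong) (auto simp: lo_def hi_def)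
    also have "\<dots> = k * (\<Prod>j\<in>UNIV - {i}. 2)"
      by (subst prod.remove[of _ i]) (auto intro!: prod.cong)
    also have "\<dots> = k / 2 * 2 ^ CARD('d)"
      by (cases "CARD('d)") (simp_all add: card_Diff_singleton)
    finally have "emeasure lborel ?E = ennreal (k / 2 * 2 ^ CARD('d))"
      by (metis emeasure_eq_ennreal_measure emeasure_lborel_cbox_finite infinity_ennreal_def less_top)
    then show ?thesis
      unfolding emeasure_unit_cube using k by (subst ennreal_mult[symmetric]) auto
  qed
  \<comment> \<open>A point of the shifted cube outside the cube has its coordinate \<open>i\<close> above 1, hence lies in the slab \<open>?E\<close>.\<close>
  have ind: "indicator ?Q (b - ?e) \<le> (indicator ?Q b + indicator ?E b :: ennreal)" for b
  proof (cases "b - ?e \<in> ?Q \<and> b \<notin> ?Q")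
    case True
    then have "\<bar>b $ j - (if j = i then k else 0)\<bar> \<le> 1" for j
      by (auto simp: linf_ball_def axis_def split: if_splits)
    then have *: "\<bar>b $ i - k\<bar> \<le> 1" "\<And>j. j \<noteq> i \<Longrightarrow> \<bar>b $ j\<bar> \<le> 1"
      by (smt (verit))+
    from True obtain j where "1 < \<bar>b $ j\<bar>"
      by (auto simp: linf_ball_def not_le)
    with * have "1 < \<bar>b $ i\<bar>"
      by (metis not_le)
    with * k have "b \<in> ?E"
      by (auto simp: mem_box_cart lo_def hi_def abs_le_iff)
    then show ?thesis
      by (simp add: indicator_def)
  qed (auto simp: indicator_def)
  have "(\<integral>\<^sup>+a. ennreal (H (a + ?e)) * indicator ?Q a \<partial>lborel) =
      (\<integral>\<^sup>+a. ennreal (H (?e + a)) * indicator ?Q ((?e + a) - ?e) \<partial>lborel)"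
    by (simp add: add.commute)
  also have "\<dots> = (\<integral>\<^sup>+b. ennreal (H b) * indicator ?Q (b - ?e) \<partial>distr lborel borel ((+) ?e))"
    by (subst nn_integral_distr) simp_all
  also have "\<dots> = (\<integral>\<^sup>+b. ennreal (H b) * indicator ?Q (b - ?e) \<partial>lborel)"
    by (simp add: lborel_distr_plus)
  also have "\<dots> \<le> (\<integral>\<^sup>+b. ennreal (H b) * indicator ?Q b + ennreal c * indicator ?E b \<partial>lborel)"
  proof (intro nn_integral_mono)
    fix b
    have "ennreal (H b) * indicator ?Q (b - ?e) \<le> ennreal (H b) * (indicator ?Q b + indicator ?E b)"
      by (intro mult_left_mono ind) simp
    also have "\<dots> \<le> ennreal (H b) * indicator ?Q b + ennreal c * indicator ?E b"
      unfolding distrib_left using c by (intro add_left_mono mult_right_mono) (auto intro: ennreal_leI)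
    finally show "ennreal (H b) * indicator ?Q (b - ?e)
        \<le> ennreal (H b) * indicator ?Q b + ennreal c * indicator ?E b" .
  qed
  also have "\<dots> = (\<integral>\<^sup>+b. ennreal (H b) * indicator ?Q b \<partial>lborel) + ennreal c * emeasure lborel ?E"
    by (subst nn_integral_add) (simp_all add: nn_integral_cmult_indicator)
  finally have "(\<integral>\<^sup>+a. ennreal (H (a + ?e)) * indicator ?Q a \<partial>lborel) / emeasure lborel ?Q
      \<le> ((\<integral>\<^sup>+b. ennreal (H b) * indicator ?Q b \<partial>lborel) + ennreal c * emeasure lborel ?E) / emeasure lborel ?Q"
    by (rule divide_right_mono_ennreal)
  also have "\<dots> = (\<integral>\<^sup>+b. ennreal (H b) * indicator ?Q b \<partial>lborel) / emeasure lborel ?Q + ennreal (c * k / 2)"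
  proof -
    have "ennreal c * emeasure lborel ?E / emeasure lborel ?Q = ennreal (c * (k / 2)) * (emeasure lborel ?Q / emeasure lborel ?Q)"
    proof -
      have "ennreal c * emeasure lborel ?E = ennreal (c * (k / 2)) * emeasure lborel ?Q"
        unfolding E using c k by (subst ennreal_mult) (auto simp: mult.assoc)
      then show ?thesis
        by (simp only: ennreal_times_divide)
    qed
    also have "emeasure lborel ?Q / emeasure lborel ?Q = 1"
      by (intro ennreal_divide_self) (auto simp: emeasure_unit_cube)
    finally show ?thesis
      by (simp add: add_divide_distrib_ennreal)
  qed
  finally show ?thesis
    by (simp add: nn_integral_uniform_measure)
qed

context polar_oracle
begin

lemma segment_centre_shift:
  assumes "0 < \<delta>" "\<delta> < 1/3"
  shows "segment_centre \<delta> (a + (c / smoothing \<delta>) *\<^sub>R axis i 1, b) w i = segment_centre \<delta> (a, b) w i + c *\<^sub>R axis i 1"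
  using parameters(1)[OF assms] by (simp add: segment_centre_def vec_eq_iff axis_def distrib_left)

lemma continuous_on_segment_centre [continuous_intros]:
  assumes "continuous_on S f" "continuous_on S h"
  shows "continuous_on S (\<lambda>q. segment_centre \<delta> (f q) (h q) i)"
  unfolding segment_centre_def
proof (rule continuous_on_vec_lambda)
  fix j
  show "continuous_on S (\<lambda>q. h q $ j + smoothing \<delta> * fst (f q) $ j
      + (if j = i then 0 else fd_step \<delta> * snd (f q) $ j))"
    using assms by (cases "j = i") (auto intro!: continuous_intros)
qed

lemma continuous_on_slope_gap [continuous_intros]:
  assumes "continuous_on S f" "\<nu> \<noteq> 0"
  shows "continuous_on S (\<lambda>q. slope_gap \<nu> e (f q))"
  unfolding slope_gap_def using assms
  by (intro continuous_intros continuous_on_compose2[OF continuous_on_gauge[of UNIV]]) auto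

lemma fd_error_measurable:
  assumes "0 < \<delta>" "\<delta> < 1/3"
  shows "(\<lambda>q. fd_error \<delta> (snd q) (fst q)) \<in> borel_measurable borel"
  unfolding fd_error_def using parameters(2)[OF assms]
  by (intro borel_measurable_continuous_onI continuous_intros) auto

text \<open>Along the random direction \<open>i\<close> the slope gap is the difference of one bounded function, the slope
\<open>H\<close> over the lower flanking interval, between two positions at distance \<open>3 * \<nu>\<close>. Averaged over
the smoothing radius, which is much larger, the difference telescopes up to the two boundary slabs. The
constant \<open>1 / r\<close> added in \<open>H\<close> makes it nonnegative.\<close>

lemma expected_slope_gap:
  fixes b :: "real^'d"
  assumes \<delta>: "0 < \<delta>" "\<delta> < 1/3"
  shows "(\<integral>\<^sup>+a. ennreal (slope_gap (fd_step \<delta>) (axis i 1) (segment_centre \<delta> (a, b) w i)) \<partial>cube_measure)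
    \<le> ennreal (3 * fd_step \<delta> / (r * smoothing \<delta>))"
proof -
  define \<nu> where "\<nu> = fd_step \<delta>"
  define k where "k = 3 * \<nu> / smoothing \<delta>"
  define e where "e = (axis i 1 :: real^'d)"
  define Y where "Y a = segment_centre \<delta> (a, b) w i" for a
  define H where "H a = (\<gamma> (Y a - \<nu> *\<^sub>R e) - \<gamma> (Y a - (2 * \<nu>) *\<^sub>R e)) / \<nu> + 1 / r" for a
  interpret cube: prob_space "cube_measure :: (real^'d) measure"
    by (rule prob_space_cube_measure)
  have \<nu>: "0 < \<nu>" and k: "0 \<le> k"
    using parameters[OF \<delta>] by (auto simp: \<nu>_def k_def)
  have cont_Y: "continuous_on UNIV Y"
    unfolding Y_def by (intro continuous_intros)
  have H_meas [measurable]: "H \<in> borel_measurable borel"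
    unfolding H_def using \<nu> cont_Y
    by (intro borel_measurable_continuous_onI continuous_intros
        continuous_on_compose2[OF continuous_on_gauge[of UNIV]]) auto
  have gap_meas [measurable]: "(\<lambda>a. slope_gap \<nu> e (Y a)) \<in> borel_measurable borel"
    using \<nu> cont_Y by (intro borel_measurable_continuous_onI continuous_intros) auto
  have H_bounds: "0 \<le> H a" "H a \<le> 2 / r" for a
  proof -
    have "(2 * \<nu>) *\<^sub>R e = \<nu> *\<^sub>R e + \<nu> *\<^sub>R e"
      by (simp add: scaleR_add_left[symmetric])
    then have step_vec: "(Y a - \<nu> *\<^sub>R e) - (Y a - (2 * \<nu>) *\<^sub>R e) = \<nu> *\<^sub>R e"
      by simp
    have "\<bar>\<gamma> (Y a - \<nu> *\<^sub>R e) - \<gamma> (Y a - (2 * \<nu>) *\<^sub>R e)\<bar> \<le> norm (\<nu> *\<^sub>R e) / r"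
      using gauge_lipschitz[of "Y a - \<nu> *\<^sub>R e" "Y a - (2 * \<nu>) *\<^sub>R e"]
      by (simp only: step_vec)
    then have "\<bar>\<gamma> (Y a - \<nu> *\<^sub>R e) - \<gamma> (Y a - (2 * \<nu>) *\<^sub>R e)\<bar> \<le> \<nu> * (1 / r)"
      using \<nu> by (simp add: e_def norm_axis_1)
    then have "\<bar>\<gamma> (Y a - \<nu> *\<^sub>R e) - \<gamma> (Y a - (2 * \<nu>) *\<^sub>R e)\<bar> / \<nu> \<le> 1 / r"
      using \<nu> by (simp only: pos_divide_le_eq mult.commute)
    then have "\<bar>(\<gamma> (Y a - \<nu> *\<^sub>R e) - \<gamma> (Y a - (2 * \<nu>) *\<^sub>R e)) / \<nu>\<bar> \<le> 1 / r"
      using \<nu> by (simp add: abs_divide)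
    then show "0 \<le> H a" "H a \<le> 2 / r"
      unfolding H_def abs_le_iff by linarith+
  qed
  have shift: "slope_gap \<nu> e (Y a) + H a = H (a + k *\<^sub>R e)" for a
  proof -
    have Y: "Y (a + k *\<^sub>R e) = Y a + (3 * \<nu>) *\<^sub>R e"
      unfolding Y_def k_def e_def by (rule segment_centre_shift[OF \<delta>])
    have "Y (a + k *\<^sub>R e) - \<nu> *\<^sub>R e = Y a + (2 * \<nu>) *\<^sub>R e"
      "Y (a + k *\<^sub>R e) - (2 * \<nu>) *\<^sub>R e = Y a + \<nu> *\<^sub>R e"
      unfolding Y add_diff_eq[symmetric] scaleR_left_diff_distrib[symmetric] by simp_all
    then show ?thesis
      by (simp add: H_def slope_gap_def diff_divide_distrib)
  qed
  \<comment> \<open>Needed to cancel the integral of \<open>H\<close> from both sides of an extended inequality.\<close>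
  have finite: "(\<integral>\<^sup>+a. ennreal (H a) \<partial>cube_measure) \<noteq> \<infinity>"
  proof -
    have "(\<integral>\<^sup>+a. ennreal (H a) \<partial>cube_measure) \<le> (\<integral>\<^sup>+a. ennreal (2 / r) \<partial>(cube_measure :: (real^'d) measure))"
      by (intro nn_integral_mono ennreal_leI H_bounds)
    also have "\<dots> = ennreal (2 / r)"
      by (subst nn_integral_const) (simp only: cube.emeasure_space_1 mult_1_right)
    finally show ?thesis
      by (metis ennreal_neq_top infinity_ennreal_def neq_top_trans)
  qed
  have "(\<integral>\<^sup>+a. ennreal (H a) \<partial>cube_measure) + (\<integral>\<^sup>+a. ennreal (slope_gap \<nu> e (Y a)) \<partial>cube_measure)
      = (\<integral>\<^sup>+a. ennreal (H a) + ennreal (slope_gap \<nu> e (Y a)) \<partial>cube_measure)"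
    by (intro nn_integral_add[symmetric]) simp_all
  also have "\<dots> = (\<integral>\<^sup>+a. ennreal (H (a + k *\<^sub>R e)) \<partial>cube_measure)"
    unfolding shift[symmetric] using H_bounds slope_gap_nonneg[OF \<nu>]
    by (intro nn_integral_cong) (simp add: add.commute)
  also have "\<dots> \<le> (\<integral>\<^sup>+a. ennreal (H a) \<partial>cube_measure) + ennreal (2 / r * k / 2)"
    unfolding e_def using k H_bounds r_pos by (intro cube_measure_shift_le) auto
  finally have "(\<integral>\<^sup>+a. ennreal (slope_gap \<nu> e (Y a)) \<partial>cube_measure) \<le> ennreal (2 / r * k / 2)"
    using finite by (simp add: ennreal_add_left_cancel_le)
  then show ?thesis
    by (simp add: \<nu>_def k_def e_def Y_def)
qed

lemma expected_fd_error:
  assumes \<delta>: "0 < \<delta>" "\<delta> < 1/3"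
  shows "(\<integral>\<^sup>+tape. ennreal (fd_error \<delta> tape w) \<partial>opt_tape) \<le> ennreal (3 * \<delta> / (10 * R))"
proof -
  interpret cube: prob_space "cube_measure :: (real^'d) measure"
    by (rule prob_space_cube_measure)
  interpret cubes: pair_sigma_finite "cube_measure :: (real^'d) measure" "cube_measure :: (real^'d) measure" ..
  let ?gap = "\<lambda>i tape. slope_gap (fd_step \<delta>) (axis i 1) (segment_centre \<delta> tape w i)"
  have cont: "continuous_on UNIV (\<lambda>tape. ?gap i tape)" for i
    using parameters(2)[OF \<delta>] by (intro continuous_intros) auto
  have sets_tape: "sets (opt_tape :: ((real^'d) \<times> (real^'d)) measure) = sets borel"
    unfolding opt_tape_def borel_prod[symmetric] by (intro sets_pair_measure_cong) simp_all
  have meas: "?gap i \<in> borel_measurable opt_tape" for i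
    using borel_measurable_continuous_onI[OF cont[of i]] by (simp cong: measurable_cong_sets add: sets_tape)
  have one: "(\<integral>\<^sup>+tape. ennreal (?gap i tape) \<partial>opt_tape) \<le> ennreal (3 * fd_step \<delta> / (r * smoothing \<delta>))" for i
  proof -
    have "(\<integral>\<^sup>+tape. ennreal (?gap i tape) \<partial>opt_tape)
        = (\<integral>\<^sup>+b. (\<integral>\<^sup>+a. ennreal (?gap i (a, b)) \<partial>cube_measure) \<partial>cube_measure)"
      unfolding opt_tape_def using meas[of i, unfolded opt_tape_def]
      by (intro cubes.nn_integral_snd[symmetric]) simp
    also have "\<dots> \<le> (\<integral>\<^sup>+b. ennreal (3 * fd_step \<delta> / (r * smoothing \<delta>)) \<partial>(cube_measure :: (real^'d) measure))"
      by (intro nn_integral_mono expected_slope_gap \<delta>)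
    also have "\<dots> = ennreal (3 * fd_step \<delta> / (r * smoothing \<delta>))"
      by (subst nn_integral_const) (simp only: cube.emeasure_space_1 mult_1_right)
    finally show ?thesis .
  qed
  have "(\<integral>\<^sup>+tape. ennreal (fd_error \<delta> tape w) \<partial>opt_tape) = (\<integral>\<^sup>+tape. (\<Sum>i\<in>UNIV. ennreal (?gap i tape)) \<partial>opt_tape)"
    unfolding fd_error_def using slope_gap_nonneg[OF parameters(2)[OF \<delta>]] by (simp add: sum_ennreal)
  also have "\<dots> = (\<Sum>i\<in>UNIV. \<integral>\<^sup>+tape. ennreal (?gap i tape) \<partial>opt_tape)"
    using meas by (intro nn_integral_sum) simp
  also have "\<dots> \<le> (\<Sum>i\<in>(UNIV :: 'd set). ennreal (3 * fd_step \<delta> / (r * smoothing \<delta>)))"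
    by (intro sum_mono one)
  also have "\<dots> = ennreal (d * (3 * fd_step \<delta> / (r * smoothing \<delta>)))"
    using parameters(1,2)[OF \<delta>] r_pos d_ge_1
    by (simp add: ennreal_mult[symmetric] ennreal_of_nat_eq_real_of_nat d_eq[symmetric])
  also have "\<dots> \<le> ennreal (3 * \<delta> / (10 * R))"
    using parameters[OF \<delta>] by (intro ennreal_leI)
  finally show ?thesis .
qed

end

section \<open>Regret of FTRL-proximal\<close>

text \<open>Completing the square: moving away from \<open>u\<close> gains at most \<open>(norm v)\<^sup>2 / (2 * S')\<close> of linear loss
before the quadratic penalty outweighs it.\<close>

lemma proximal_step_gain:
  fixes u u' v :: "'v::real_inner"
  assumes "0 < S'"
  shows "v \<bullet> u - (norm v)\<^sup>2 / (2 * S') \<le> S' / 2 * (norm (u' - u))\<^sup>2 + v \<bullet> u'"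
proof -
  have "0 \<le> (norm (S' *\<^sub>R (u' - u) + v))\<^sup>2"
    by simp
  also have "\<dots> = S'\<^sup>2 * (norm (u' - u))\<^sup>2 + 2 * S' * (v \<bullet> (u' - u)) + (norm v)\<^sup>2"
    unfolding power2_norm_eq_inner inner_add_left inner_add_right inner_scaleR_left inner_scaleR_right
    by (simp add: inner_commute power2_eq_square distrib_left)
  also have "\<dots> = (2 * S') * (S' / 2 * (norm (u' - u))\<^sup>2 + v \<bullet> (u' - u) + (norm v)\<^sup>2 / (2 * S'))"
    using assms by (simp add: field_simps power2_eq_square)
  finally have "0 \<le> S' / 2 * (norm (u' - u))\<^sup>2 + v \<bullet> (u' - u) + (norm v)\<^sup>2 / (2 * S')"
    using assms by (simp add: zero_le_mult_iff)
  then show ?thesis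
    using assms by (simp add: inner_diff_right algebra_simps)
qed

text \<open>The variational inequality of the Euclidean projection, rewritten as strong convexity of
\<open>\<lambda>y. S / 2 * (norm y)\<^sup>2 - b \<bullet> y\<close> at its constrained minimiser.\<close>

lemma quadratic_min_on_convex:
  fixes b y :: "'v::euclidean_space"
  assumes "0 < S" "convex K" "closed K" "y \<in> K"
  defines "u \<equiv> closest_point K (b /\<^sub>R S)"
  shows "S / 2 * (norm u)\<^sup>2 - b \<bullet> u + S / 2 * (norm (y - u))\<^sup>2 \<le> S / 2 * (norm y)\<^sup>2 - b \<bullet> y"
proof -
  have "(b /\<^sub>R S - u) \<bullet> (y - u) \<le> 0"
    unfolding u_def using assms by (intro closest_point_dot) auto
  then have "S * ((b /\<^sub>R S - u) \<bullet> (y - u)) \<le> 0"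
    using assms by (simp add: mult_le_0_iff)
  also have "S * ((b /\<^sub>R S - u) \<bullet> (y - u)) = b \<bullet> (y - u) - S * (u \<bullet> (y - u))"
    using assms by (simp add: inner_diff_left right_diff_distrib)
  finally have *: "b \<bullet> y - b \<bullet> u \<le> S * (u \<bullet> y) - S * (u \<bullet> u)"
    by (simp add: inner_diff_right algebra_simps)
  have "S / 2 * (norm (y - u))\<^sup>2 = S / 2 * (norm y)\<^sup>2 - S * (u \<bullet> y) + S / 2 * (norm u)\<^sup>2"
    by (simp add: power2_norm_eq_inner inner_diff_left inner_diff_right inner_commute algebra_simps)
  moreover have "S * (u \<bullet> u) = S / 2 * (norm u)\<^sup>2 + S / 2 * (norm u)\<^sup>2"
    by (simp add: power2_norm_eq_inner)
  ultimately show ?thesis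
    using * by linarith
qed

text \<open>A run of FTRL-proximal in which round \<open>n + 1\<close> (counting from 1) takes the state \<open>st n\<close> to
\<open>st (Suc n)\<close> with gradient \<open>v n\<close>.\<close>

locale ftrl_run =
  fixes D :: real and v :: "nat \<Rightarrow> 'v::euclidean_space" and st :: "nat \<Rightarrow> 'v ftrl_state"
  assumes D: "0 < D"
    and st_0: "st 0 = start (ftrl_proximal D)"
    and st_Suc: "\<And>n. st (Suc n) = ftrl_update D (st n) (v n)"
begin

text \<open>\<open>S n\<close> is the inverse of the learning rate after \<open>n\<close> rounds. The state keeps the sum of the
increments of this quantity, so its field \<open>sigma_sum\<close> telescopes to \<open>S n\<close>.\<close>

definition V :: "nat \<Rightarrow> real" where "V n = (\<Sum>s<n. (norm (v s))\<^sup>2)"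
definition S :: "nat \<Rightarrow> real" where "S n = sqrt (V n) / (sqrt 2 * D)"

lemma V_mono: "m \<le> n \<Longrightarrow> V m \<le> V n"
  unfolding V_def by (intro sum_mono2) auto

lemma V_nonneg: "0 \<le> V n"
  unfolding V_def by (intro sum_nonneg) auto

lemma S_nonneg: "0 \<le> S n"
  using V_nonneg D by (simp add: S_def)

lemma S_mono: "S n \<le> S (Suc n)"
  using V_mono[of n "Suc n"] D unfolding S_def by (intro divide_right_mono) auto

lemma state_invariant:
  "grad_sum (st n) = (\<Sum>s<n. v s)"
  "sq_sum (st n) = V n"
  "sigma_sum (st n) = S n"
  "prox_sum (st n) = (\<Sum>s<n. (S (Suc s) - S s) *\<^sub>R iterate (st s))"
proof -
  have "grad_sum (st n) = (\<Sum>s<n. v s) \<and> sq_sum (st n) = V n \<and> sigma_sum (st n) = S n \<and>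
      prox_sum (st n) = (\<Sum>s<n. (S (Suc s) - S s) *\<^sub>R iterate (st s))"
  proof (induction n)
    case 0
    then show ?case
      by (simp add: st_0 ftrl_proximal_def V_def S_def)
  next
    case (Suc n)
    have eta: "1 / ftrl_eta D (V m) = S m" for m
      by (simp add: ftrl_eta_def S_def)
    have "V n + (norm (v n))\<^sup>2 = V (Suc n)"
      by (simp add: V_def)
    with Suc show ?case
      by (simp add: st_Suc ftrl_update_def Let_def eta)
  qed
  then show "grad_sum (st n) = (\<Sum>s<n. v s)" "sq_sum (st n) = V n" "sigma_sum (st n) = S n"
      "prox_sum (st n) = (\<Sum>s<n. (S (Suc s) - S s) *\<^sub>R iterate (st s))"
    by auto
qed

lemma iterate_Suc:
  "iterate (st (Suc n)) = (if S (Suc n) = 0 then 0 else closest_point (cball 0 D)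
     ((- (\<Sum>s<Suc n. v s) + (\<Sum>s<Suc n. (S (Suc s) - S s) *\<^sub>R iterate (st s))) /\<^sub>R S (Suc n)))"
proof -
  have "iterate (st (Suc n)) = (if sigma_sum (st (Suc n)) = 0 then 0 else closest_point (cball 0 D)
     ((- grad_sum (st (Suc n)) + prox_sum (st (Suc n))) /\<^sub>R sigma_sum (st (Suc n))))"
    unfolding st_Suc ftrl_update_def Let_def by simp
  then show ?thesis
    unfolding state_invariant .
qed

lemma iterate_in_ball: "norm (iterate (st n)) \<le> D"
proof (cases n)
  case 0
  then show ?thesis
    using D by (simp add: st_0 ftrl_proximal_def)
next
  case (Suc m)
  have "closest_point (cball 0 D) a \<in> cball 0 D" for a :: 'v
    using D by (intro closest_point_in_set) auto
  then show ?thesis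
    using D by (simp add: Suc iterate_Suc)
qed

text \<open>Induction over the rounds, with the strong convexity term kept in the induction hypothesis and the
comparator \<open>y\<close> arbitrary. The objective of round \<open>n + 1\<close> at its minimiser \<open>u'\<close> is
compared with the hypothesis at \<open>y = u'\<close>; the proximal term added in round \<open>n + 1\<close> is
centred at the previous iterate \<open>u\<close>, so it joins the strong convexity term, and
\<open>proximal_step_gain\<close> applies with the new modulus. While \<open>S (Suc n) = 0\<close> all gradients
vanish and both sides are zero.\<close>

lemma be_the_leader:
  assumes y: "norm y \<le> D"
  shows "(\<Sum>s<n. v s \<bullet> iterate (st s) - (norm (v s))\<^sup>2 / (2 * S (Suc s)))
      + S n / 2 * (norm (y - iterate (st n)))\<^sup>2
    \<le> (\<Sum>s<n. v s \<bullet> y + (S (Suc s) - S s) / 2 * (norm (y - iterate (st s)))\<^sup>2)"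
  using y
proof (induction n arbitrary: y)
  case 0
  then show ?case
    by (simp add: S_def V_def)
next
  case (Suc n)
  define u where "u = iterate (st n)"
  define u' where "u' = iterate (st (Suc n))"
  define \<Phi> where "\<Phi> y = (\<Sum>s<Suc n. v s \<bullet> y + (S (Suc s) - S s) / 2 * (norm (y - iterate (st s)))\<^sup>2)" for y
  show ?case
  proof (cases "S (Suc n) = 0")
    case True
    then have "V (Suc n) = 0"
      using D by (simp add: S_def)
    then have v0: "v s = 0" if "s < Suc n" for s
      using that by (simp add: V_def sum_nonneg_eq_0_iff del: sum.lessThan_Suc)
    have "S s = 0" if "s \<le> Suc n" for s
      using v0 that by (simp add: S_def V_def)
    then show ?thesis
      using v0 by simp
  next
    case False
    then have S': "0 < S (Suc n)"
      using S_nonneg[of "Suc n"] by simp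
    define b where "b = - (\<Sum>s<Suc n. v s) + (\<Sum>s<Suc n. (S (Suc s) - S s) *\<^sub>R iterate (st s))"
    define c where "c = (\<Sum>s<Suc n. (S (Suc s) - S s) / 2 * (norm (iterate (st s)))\<^sup>2)"
    have \<Phi>: "\<Phi> y = S (Suc n) / 2 * (norm y)\<^sup>2 - b \<bullet> y + c" for y
    proof -
      have nrm: "(norm (y - z))\<^sup>2 = (norm y)\<^sup>2 - 2 * (z \<bullet> y) + (norm z)\<^sup>2" for z
        by (simp add: power2_norm_eq_inner inner_diff_left inner_diff_right inner_commute)
      have expand: "l + \<sigma> / 2 * (a - 2 * p + b) = a / 2 * \<sigma> + l - \<sigma> * p + \<sigma> / 2 * b" for l \<sigma> a p b :: real
        by (simp add: field_simps)
      have split_sum: "(\<Sum>s<Suc n. A s + B s - C s + E s) =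
          (\<Sum>s<Suc n. A s) + (\<Sum>s<Suc n. B s) - (\<Sum>s<Suc n. C s) + (\<Sum>s<Suc n. E s)"
        for A B C E :: "nat \<Rightarrow> real"
        by (simp only: sum.distrib sum_subtractf)
      have "\<Phi> y = (\<Sum>s<Suc n. (norm y)\<^sup>2 / 2 * (S (Suc s) - S s) + v s \<bullet> y
          - ((S (Suc s) - S s) *\<^sub>R iterate (st s)) \<bullet> y + (S (Suc s) - S s) / 2 * (norm (iterate (st s)))\<^sup>2)"
        unfolding \<Phi>_def nrm expand inner_scaleR_left ..
      also have "\<dots> = (norm y)\<^sup>2 / 2 * (\<Sum>s<Suc n. S (Suc s) - S s) + (\<Sum>s<Suc n. v s) \<bullet> y
          - (\<Sum>s<Suc n. (S (Suc s) - S s) *\<^sub>R iterate (st s)) \<bullet> y + c"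
        unfolding c_def split_sum sum_distrib_left inner_sum_left ..
      also have "(\<Sum>s<Suc n. S (Suc s) - S s) = S (Suc n)"
        by (subst sum_lessThan_telescope) (simp add: S_def V_def)
      finally show ?thesis
        by (simp add: b_def inner_diff_left inner_add_left del: sum.lessThan_Suc)
    qed
    have u': "u' = closest_point (cball 0 D) (b /\<^sub>R S (Suc n))"
      using S' unfolding u'_def iterate_Suc b_def by auto
    have opt: "\<Phi> u' + S (Suc n) / 2 * (norm (y - u'))\<^sup>2 \<le> \<Phi> y"
      using quadratic_min_on_convex[OF S', of "cball 0 D" y b] Suc.prems
      unfolding \<Phi> u' by simp
    have "norm u' \<le> D"
      unfolding u'_def by (rule iterate_in_ball)
    note IH = Suc.IH[OF this, folded u_def]
    have "\<Phi> u' = (\<Sum>s<n. v s \<bullet> u' + (S (Suc s) - S s) / 2 * (norm (u' - iterate (st s)))\<^sup>2)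
        + (v n \<bullet> u' + (S (Suc n) - S n) / 2 * (norm (u' - u))\<^sup>2)"
      by (simp add: \<Phi>_def u_def)
    moreover have "S n / 2 * X + (S (Suc n) - S n) / 2 * X = S (Suc n) / 2 * X" for X
      by (simp add: field_simps)
    note this[of "(norm (u' - u))\<^sup>2"]
    moreover note IH proximal_step_gain[OF S', of "v n" u u']
    ultimately
    have "(\<Sum>s<Suc n. v s \<bullet> iterate (st s) - (norm (v s))\<^sup>2 / (2 * S (Suc s))) \<le> \<Phi> u'"
      unfolding sum.lessThan_Suc u_def by linarith
    with opt show ?thesis
      by (simp only: \<Phi>_def u'_def)
  qed
qed

text \<open>With \<open>p\<close> and \<open>q\<close> the square roots of successive values of \<open>V\<close>, one summand is a multiple
of \<open>(q\<^sup>2 - p\<^sup>2) / (2 * q)\<close>, which is at most \<open>q - p\<close>; the sum then telescopes.\<close>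

lemma adaptive_step_sum: "(\<Sum>s<n. (norm (v s))\<^sup>2 / (2 * S (Suc s))) \<le> sqrt 2 * D * sqrt (V n)"
proof (induction n)
  case 0
  then show ?case by (simp add: V_def)
next
  case (Suc n)
  define p where "p = sqrt (V n)"
  define q where "q = sqrt (V (Suc n))"
  have pq: "0 \<le> p" "p \<le> q"
    using V_nonneg V_mono[of n "Suc n"] by (auto simp: p_def q_def)
  have "(norm (v n))\<^sup>2 = q\<^sup>2 - p\<^sup>2"
    using V_nonneg[of n] V_nonneg[of "Suc n"] by (simp add: p_def q_def V_def)
  then have "(norm (v n))\<^sup>2 / (2 * S (Suc n)) = sqrt 2 * D * ((q\<^sup>2 - p\<^sup>2) / (2 * q))"
    by (simp add: S_def q_def[symmetric])
  also have "\<dots> \<le> sqrt 2 * D * (q - p)"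
  proof (intro mult_left_mono)
    show "(q\<^sup>2 - p\<^sup>2) / (2 * q) \<le> q - p"
    proof (cases "q = 0")
      case False
      then have "0 < q" using pq by simp
      moreover have "q\<^sup>2 - p\<^sup>2 \<le> (q - p) * (2 * q)"
        using mult_left_mono[of p q "q - p"] pq by (simp add: power2_eq_square algebra_simps)
      ultimately show ?thesis
        by (simp add: pos_divide_le_eq)
    qed (use pq in simp)
  qed (use D in simp)
  finally show ?case
    using Suc by (simp add: p_def q_def right_diff_distrib)
qed

text \<open>The proximal terms and the stability terms each contribute \<open>sqrt 2 * D * sqrt (V n)\<close>: this balance
is what fixes the factor \<open>sqrt 2\<close> in the learning rate.\<close>

lemma ftrl_regret:
  assumes y: "norm y \<le> D"
  shows "(\<Sum>s<n. v s \<bullet> (iterate (st s) - y)) \<le> 2 * sqrt 2 * D * sqrt (\<Sum>s<n. (norm (v s))\<^sup>2)"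
proof -
  have "(S (Suc s) - S s) / 2 * (norm (y - iterate (st s)))\<^sup>2 \<le> 2 * D\<^sup>2 * (S (Suc s) - S s)" for s
  proof -
    have "norm (y - iterate (st s)) \<le> 2 * D"
      using norm_triangle_ineq4[of y "iterate (st s)"] y iterate_in_ball[of s] by linarith
    then have "(norm (y - iterate (st s)))\<^sup>2 \<le> (2 * D)\<^sup>2"
      by (intro power_mono) auto
    then have "(S (Suc s) - S s) / 2 * (norm (y - iterate (st s)))\<^sup>2 \<le> (S (Suc s) - S s) / 2 * (2 * D)\<^sup>2"
      using S_mono[of s] by (intro mult_left_mono) auto
    also have "\<dots> = 2 * D\<^sup>2 * (S (Suc s) - S s)"
      by (simp add: power_mult_distrib)
    finally show ?thesis .
  qed
  then have "(\<Sum>s<n. (S (Suc s) - S s) / 2 * (norm (y - iterate (st s)))\<^sup>2) \<le> (\<Sum>s<n. 2 * D\<^sup>2 * (S (Suc s) - S s))"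
    by (intro sum_mono)
  also have "\<dots> = 2 * D\<^sup>2 * S n"
    unfolding sum_distrib_left[symmetric] by (subst sum_lessThan_telescope) (simp add: S_def V_def)
  also have "\<dots> = sqrt 2 * D * sqrt (V n)"
    using D by (simp add: S_def power2_eq_square field_simps)
  finally have prox: "(\<Sum>s<n. (S (Suc s) - S s) / 2 * (norm (y - iterate (st s)))\<^sup>2) \<le> sqrt 2 * D * sqrt (V n)" .
  have "0 \<le> S n / 2 * (norm (y - iterate (st n)))\<^sup>2"
    using S_nonneg[of n] by simp
  with be_the_leader[OF y, of n] prox adaptive_step_sum[of n]
  show ?thesis
    by (simp add: sum.distrib sum_subtractf inner_diff_right V_def)
qed

end

section \<open>Regret of the wrapper\<close>

context polar_oracle
begin

lemma play_in_body:
  assumes \<delta>: "0 < \<delta>" "\<delta> < 1/3" and w: "norm w \<le> R"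
  shows "wrapper_play (opt_polar mem r R \<delta> tape w) w \<in> C"
proof -
  define G where "G = gau mem r R w \<delta>"
  have G: "(G = 0 \<and> \<gamma> w \<le> 1 / 2 + \<delta> / 32) \<or> (\<gamma> w \<le> G \<and> G \<le> \<gamma> w + \<delta>)"
    unfolding G_def using \<delta> w R_pos by (intro gau_correct[OF mem_correct r_le_R]) auto
  have x: "wrapper_play (opt_polar mem r R \<delta> tape w) w = (if 1 \<le> G then w /\<^sub>R G else w)"
    by (simp add: wrapper_play_def opt_polar_eq Let_def G_def)
  show ?thesis
  proof (cases "1 \<le> G")
    case True
    then have "\<gamma> (w /\<^sub>R G) = \<gamma> w / G"
      by (simp add: gauge_scale divide_inverse_commute)
    with True G show ?thesis
      unfolding x mem_body_iff by auto
  next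
    case False
    with G \<delta> show ?thesis
      unfolding x mem_body_iff by auto
  qed
qed

text \<open>If \<open>g \<bullet> w < 0\<close> and the gauge estimate \<open>G\<close> is at least 1, put \<open>a = - (g \<bullet> x) \<ge> 0\<close>. Then
the surrogate gradient is \<open>g + a *\<^sub>R s\<close>, and the two linear losses differ by
\<open>a * (s \<bullet> (w - x') - G + 1)\<close>. For a subgradient \<open>p\<close> of the gauge at \<open>w\<close> in place of
\<open>s\<close> this is nonnegative up to errors, as \<open>p \<bullet> x' \<le> 1\<close> and \<open>p \<bullet> w\<close> is about
\<open>\<gamma> w\<close>, and so about \<open>G\<close>. In all other cases the gradient is passed on unchanged, and shrinking
\<open>w\<close> to \<open>x\<close> does not increase the loss.\<close>

lemma surrogate_loss_bound:
  assumes \<delta>: "0 < \<delta>" "\<delta> < 1/3" and w: "norm w \<le> R"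
    and tape: "fst tape \<in> linf_ball 0 1" "snd tape \<in> linf_ball 0 1"
  defines "out \<equiv> opt_polar mem r R \<delta> tape w" and "err \<equiv> R * fd_error \<delta> tape w + \<delta>"
  shows "norm (wrapper_grad out w g) \<le> norm g * (1 + R / r + err)"
    and "x' \<in> C \<Longrightarrow> g \<bullet> (wrapper_play out w - x') \<le> wrapper_grad out w g \<bullet> (w - x') + 2 * R * norm g * err"
proof -
  define G where "G = gau mem r R w \<delta>"
  define s where "s = snd out"
  define x where "x = wrapper_play out w"
  define E where "E = fd_error \<delta> tape w"
  have out: "out = (G, s)"
    by (simp add: out_def opt_polar_eq Let_def G_def s_def)
  have G: "(G = 0 \<and> \<gamma> w \<le> 1 / 2 + \<delta> / 32) \<or> (\<gamma> w \<le> G \<and> G \<le> \<gamma> w + \<delta>)"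
    unfolding G_def using \<delta> w R_pos by (intro gau_correct[OF mem_correct r_le_R]) auto
  have x: "x = (if 1 \<le> G then w /\<^sub>R G else w)"
    by (simp add: x_def wrapper_play_def out)
  have grad: "wrapper_grad out w g = g - (if g \<bullet> w < 0 \<and> 1 \<le> G then (g \<bullet> x) *\<^sub>R s else 0)"
    by (simp add: wrapper_grad_def out x_def Let_def)
  have E: "0 \<le> E"
    unfolding E_def by (rule fd_error_nonneg[OF \<delta>])
  have err: "err = R * E + \<delta>" "0 \<le> err"
    using E \<delta> R_pos by (auto simp: err_def E_def)
  have "norm (wrapper_grad out w g) \<le> norm g * (1 + R / r + err) \<and>
    (x' \<in> C \<longrightarrow> g \<bullet> (x - x') \<le> wrapper_grad out w g \<bullet> (w - x') + 2 * R * norm g * err)"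
  proof (cases "g \<bullet> w < 0 \<and> 1 \<le> G")
    case False
    then have "g \<bullet> x \<le> g \<bullet> w"
      using mult_right_mono[of "inverse G" 1 "g \<bullet> w"] by (auto simp: x inverse_le_1_iff)
    moreover have "norm g * 1 \<le> norm g * (1 + R / r + err)"
      using r_pos R_pos err by (intro mult_left_mono) auto
    moreover have "0 \<le> 2 * R * norm g * err"
      using err R_pos by simp
    moreover have grad_eq: "wrapper_grad out w g = g"
      using False by (auto simp: grad)
    ultimately show ?thesis
      unfolding grad_eq inner_diff_right by linarith
  next
    case True
    then have "1 \<le> fst (opt_polar mem r R \<delta> tape w)"
      by (simp add: out_def[symmetric] out)
    from opt_polar_near_subgradient[OF \<delta> w tape this]
    obtain p where p: "p \<in> polar_body C" "\<gamma> w - \<delta> / 4 \<le> p \<bullet> w"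
      "norm (s - p) \<le> E + \<delta> / (20 * R)"
      unfolding s_def E_def out_def by metis
    define a where "a = - (g \<bullet> x)"
    have gx: "g \<bullet> w = G * (g \<bullet> x)"
      using True by (simp add: x)
    have a_pos: "0 \<le> a"
      using True gx by (auto simp: a_def mult_less_0_iff)
    have "norm x \<le> norm w"
      using True mult_right_mono[of "inverse G" 1 "norm w"] by (auto simp: x inverse_le_1_iff)
    then have "a \<le> norm g * R"
      using norm_cauchy_schwarz[of g "- x"] mult_left_mono[of "norm x" R "norm g"] w by (simp add: a_def)
    have sp: "R * norm (s - p) \<le> R * E + \<delta> / 20"
      using mult_left_mono[OF p(3), of R] R_pos by (simp add: distrib_left)
    have "a * norm s \<le> (norm g * R) * (1 / r + norm (s - p))"
      using norm_triangle_ineq[of "s - p" p] norm_polar_le[OF p(1)] \<open>a \<le> norm g * R\<close> R_pos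
      by (intro mult_mono) auto
    also have "\<dots> = norm g * (R / r + R * norm (s - p))"
      by (simp add: algebra_simps)
    also have "\<dots> \<le> norm g * (R / r + err)"
      using sp \<delta> err by (intro mult_left_mono) auto
    finally have "norm g + a * norm s \<le> norm g * (1 + R / r + err)"
      by (simp add: algebra_simps)
    moreover have grad_eq: "wrapper_grad out w g = g + a *\<^sub>R s"
      using True by (simp add: grad a_def)
    moreover have "norm (g + a *\<^sub>R s) \<le> norm g + a * norm s"
      using norm_triangle_ineq[of g "a *\<^sub>R s"] a_pos by simp
    ultimately have bound: "norm (wrapper_grad out w g) \<le> norm g * (1 + R / r + err)"
      by simp
    have "g \<bullet> (x - x') \<le> wrapper_grad out w g \<bullet> (w - x') + 2 * R * norm g * err" if x': "x' \<in> C"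
    proof -
      have "norm (w - x') \<le> 2 * R"
        using norm_triangle_ineq4[of w x'] w x' body_bounded by fastforce
      then have "norm (s - p) * norm (w - x') \<le> norm (s - p) * (2 * R)"
        by (intro mult_left_mono) auto
      then have "- (2 * R) * norm (s - p) \<le> (s - p) \<bullet> (w - x')"
        using Cauchy_Schwarz_ineq2[of "s - p" "w - x'"] by (simp add: mult_ac abs_le_iff)
      moreover have "p \<bullet> x' \<le> 1"
        using p(1) x' by (auto simp: polar_body_def)
      ultimately have "- (2 * err) \<le> s \<bullet> (w - x') - G + 1"
        using p(2) sp G True \<delta> err(1) by (auto simp: inner_diff_left inner_diff_right)
      then have "a * (- (2 * err)) \<le> a * (s \<bullet> (w - x') - G + 1)"
        using a_pos by (intro mult_left_mono)
      moreover have "a * (2 * err) \<le> norm g * R * (2 * err)"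
        using \<open>a \<le> norm g * R\<close> err by (intro mult_right_mono) auto
      moreover have "wrapper_grad out w g \<bullet> (w - x') - g \<bullet> (x - x') = a * (s \<bullet> (w - x') - G + 1)"
        using gx by (simp add: grad_eq a_def inner_add_left inner_diff_right algebra_simps)
      ultimately show ?thesis
        by (simp add: mult_ac)
    qed
    with bound show ?thesis by blast
  qed
  then show "norm (wrapper_grad out w g) \<le> norm g * (1 + R / r + err)"
    and "x' \<in> C \<Longrightarrow> g \<bullet> (wrapper_play out w - x') \<le> wrapper_grad out w g \<bullet> (w - x') + 2 * R * norm g * err"
    by (auto simp: x_def)
qed

end

lemma wrapper_ftrl_regret:
  fixes orc :: "nat \<Rightarrow> 'v::euclidean_space \<Rightarrow> real \<times> 'v" and g :: "nat \<Rightarrow> 'v"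
  assumes D: "0 < D"
  defines "w \<equiv> wrapper_w (ftrl_proximal D) orc g"
  shows "norm (w t) \<le> D"
    and "norm y \<le> D \<Longrightarrow> (\<Sum>t=1..T. wrapper_grad (orc t (w t)) (w t) (g t) \<bullet> (w t - y))
      \<le> 2 * sqrt 2 * D * sqrt (\<Sum>t=1..T. (norm (wrapper_grad (orc t (w t)) (w t) (g t)))\<^sup>2)"
proof -
  define st where "st = wrapper_state (ftrl_proximal D) orc g"
  define v where "v n = wrapper_grad (orc (Suc n) (w (Suc n))) (w (Suc n)) (g (Suc n))" for n
  have w: "w t = iterate (st (t - 1))" for t
    by (simp add: w_def wrapper_w_def st_def ftrl_proximal_def)
  interpret ftrl_run D v st
    using D by unfold_locales
      (simp_all add: st_def v_def w_def wrapper_w_def ftrl_proximal_def Let_def)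
  show "norm (w t) \<le> D"
    unfolding w by (rule iterate_in_ball)
  assume "norm y \<le> D"
  from ftrl_regret[OF this, of T]
  show "(\<Sum>t=1..T. wrapper_grad (orc t (w t)) (w t) (g t) \<bullet> (w t - y))
      \<le> 2 * sqrt 2 * D * sqrt (\<Sum>t=1..T. (norm (wrapper_grad (orc t (w t)) (w t) (g t)))\<^sup>2)"
    by (simp add: sum.atLeast1_atMost_eq v_def w)
qed

context polar_oracle
begin

text \<open>On every run whose tapes lie in the unit cube. The estimation errors enter twice: directly in the
comparison of the losses, and through the norms of the surrogate gradients in the regret of
FTRL-proximal, where Minkowski's inequality separates them from the leading term.\<close>

lemma wrapper_regret:
  fixes tape :: "nat \<Rightarrow> (real^'d) \<times> (real^'d)" and g :: "nat \<Rightarrow> real^'d" and \<tau> :: "nat \<Rightarrow> real"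
  defines "orc \<equiv> \<lambda>t. opt_polar mem r R (\<tau> t) (tape t)"
  defines "w \<equiv> wrapper_w (ftrl_proximal R) orc g" and "x \<equiv> wrapper_x (ftrl_proximal R) orc g"
  assumes \<tau>: "\<And>t. 1 \<le> t \<Longrightarrow> 0 < \<tau> t \<and> \<tau> t < 1/3"
    and tape: "\<And>t. t \<in> {1..T} \<Longrightarrow> fst (tape t) \<in> linf_ball 0 1 \<and> snd (tape t) \<in> linf_ball 0 1"
    and T: "1 \<le> T" and x': "x' \<in> C"
  shows "(\<Sum>t=1..T. g t \<bullet> (x t - x')) \<le> 3 * (1 + R / r) * R * sqrt (\<Sum>t=1..T. (norm (g t))\<^sup>2)
    + 5 * R * (MAX t\<in>{1..T}. norm (g t)) * (\<Sum>t=1..T. R * fd_error (\<tau> t) (tape t) (w t) + \<tau> t)"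
proof -
  define b where "b t = R * fd_error (\<tau> t) (tape t) (w t) + \<tau> t" for t
  define v where "v t = wrapper_grad (orc t (w t)) (w t) (g t)" for t
  define Mx where "Mx = (MAX t\<in>{1..T}. norm (g t))"
  define L where "L = sqrt (\<Sum>t=1..T. (norm (g t))\<^sup>2)"
  have x_play: "x t = wrapper_play (orc t (w t)) (w t)" for t
    by (simp add: x_def w_def wrapper_x_def Let_def)
  have w_ball: "norm (w t) \<le> R" for t
    unfolding w_def by (rule wrapper_ftrl_regret[OF R_pos])
  have v_norm: "norm (v t) \<le> norm (g t) * (1 + R / r + b t)"
    and loss: "g t \<bullet> (x t - x') \<le> v t \<bullet> (w t - x') + 2 * R * norm (g t) * b t" if "t \<in> {1..T}" for t
    using surrogate_loss_bound[OF _ _ w_ball[of t], of "\<tau> t" "tape t"] \<tau>[of t] tape[OF that] that x'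
    by (auto simp: v_def orc_def b_def x_play)
  have b_nonneg: "0 \<le> b t" if "t \<in> {1..T}" for t
    using fd_error_nonneg[of "\<tau> t"] \<tau>[of t] that R_pos by (auto simp: b_def)
  have Mx: "norm (g t) \<le> Mx" if "t \<in> {1..T}" for t
    unfolding Mx_def using that by (intro Max_ge) auto
  have "norm (g 1) \<le> Mx"
    using T by (intro Mx) auto
  then have Mx_nonneg: "0 \<le> Mx"
    using norm_ge_zero[of "g 1"] by linarith
  have gb: "(\<Sum>t=1..T. norm (g t) * b t) \<le> Mx * (\<Sum>t=1..T. b t)"
    unfolding sum_distrib_left using Mx b_nonneg by (intro sum_mono mult_right_mono) auto
  have "sqrt (\<Sum>t=1..T. (norm (v t))\<^sup>2) = L2_set (\<lambda>t. norm (v t)) {1..T}"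
    by (simp add: L2_set_def)
  also have "\<dots> \<le> L2_set (\<lambda>t. (1 + R / r) * norm (g t) + norm (g t) * b t) {1..T}"
    using v_norm by (intro L2_set_mono) (auto simp: algebra_simps)
  also have "\<dots> \<le> L2_set (\<lambda>t. (1 + R / r) * norm (g t)) {1..T} + L2_set (\<lambda>t. norm (g t) * b t) {1..T}"
    by (rule L2_set_triangle_ineq)
  also have "L2_set (\<lambda>t. (1 + R / r) * norm (g t)) {1..T} = (1 + R / r) * L"
    using r_pos R_pos by (subst L2_set_right_distrib[symmetric]) (auto simp: L2_set_def L_def)
  also have "L2_set (\<lambda>t. norm (g t) * b t) {1..T} \<le> (\<Sum>t=1..T. norm (g t) * b t)"
    using b_nonneg by (intro L2_set_le_sum) auto
  finally have v_sq: "sqrt (\<Sum>t=1..T. (norm (v t))\<^sup>2) \<le> (1 + R / r) * L + Mx * (\<Sum>t=1..T. b t)"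
    using gb by linarith
  have sqrt2: "2 * sqrt 2 \<le> 3"
    using real_le_lsqrt[of "3 / 2" 2] by (simp add: power2_eq_square)
  have "norm x' \<le> R"
    using x' body_bounded by auto
  then have "(\<Sum>t=1..T. v t \<bullet> (w t - x')) \<le> 2 * sqrt 2 * R * sqrt (\<Sum>t=1..T. (norm (v t))\<^sup>2)"
    unfolding v_def w_def by (rule wrapper_ftrl_regret[OF R_pos])
  also have "\<dots> \<le> 3 * R * ((1 + R / r) * L + Mx * (\<Sum>t=1..T. b t))"
    using sqrt2 v_sq R_pos by (intro mult_mono mult_right_mono) (auto intro!: sum_nonneg)
  finally have regret: "(\<Sum>t=1..T. v t \<bullet> (w t - x')) \<le> 3 * R * ((1 + R / r) * L + Mx * (\<Sum>t=1..T. b t))" .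
  have "(\<Sum>t=1..T. g t \<bullet> (x t - x')) \<le> (\<Sum>t=1..T. v t \<bullet> (w t - x') + 2 * R * norm (g t) * b t)"
    by (intro sum_mono loss) auto
  also have "\<dots> = (\<Sum>t=1..T. v t \<bullet> (w t - x')) + 2 * R * (\<Sum>t=1..T. norm (g t) * b t)"
    by (simp add: sum.distrib sum_distrib_left mult.assoc)
  also have "2 * R * (\<Sum>t=1..T. norm (g t) * b t) \<le> 2 * R * (Mx * (\<Sum>t=1..T. b t))"
    using gb R_pos by (intro mult_left_mono) auto
  finally have "(\<Sum>t=1..T. g t \<bullet> (x t - x')) \<le>
      3 * R * ((1 + R / r) * L + Mx * (\<Sum>t=1..T. b t)) + 2 * R * (Mx * (\<Sum>t=1..T. b t))"
    using regret by linarith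
  also have "\<dots> = 3 * (1 + R / r) * R * L + 5 * R * Mx * (\<Sum>t=1..T. b t)"
    by (simp add: distrib_left mult_ac)
  finally show ?thesis
    by (simp only: b_def Mx_def L_def)
qed

end

lemma sum_inverse_squares_le: "(\<Sum>t=1..n. 1 / (real t)\<^sup>2) \<le> 2"
proof -
  have "(\<Sum>t=1..Suc n. 1 / (real t)\<^sup>2) \<le> 2 - 1 / real (Suc n)" for n
  proof (induction n)
    case (Suc n)
    have "1 / (real (Suc (Suc n)))\<^sup>2 \<le> 1 / real (Suc n) - 1 / real (Suc (Suc n))"
    proof -
      have "1 / (real (Suc (Suc n)))\<^sup>2 \<le> 1 / (real (Suc n) * real (Suc (Suc n)))"
        unfolding power2_eq_square by (intro divide_left_mono mult_right_mono) auto
      then show ?thesis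
        by (simp add: field_simps)
    qed
    with Suc show ?case by simp
  qed simp
  note bound = this
  show ?thesis
  proof (cases n)
    case (Suc m)
    have "0 \<le> 1 / real (Suc m)"
      by simp
    with bound[of m] show ?thesis
      unfolding Suc by linarith
  qed simp
qed

text \<open>Conditioning on the past without conditional expectations: if \<open>Y\<close> is independent of \<open>F\<close>
and \<open>X\<close> is known at \<open>F\<close>, the joint law is a product, so a bound on the integral over \<open>Y\<close>
that is uniform in \<open>X\<close> survives the outer integral.\<close>

lemma (in prob_space) nn_integral_independent_le:
  assumes sub: "subalgebra M F" and X: "X \<in> F \<rightarrow>\<^sub>M S" and Y: "Y \<in> M \<rightarrow>\<^sub>M N"
    and indep: "indep_set (sets F) {Y -` A \<inter> space M | A. A \<in> sets N}"
    and K: "(\<lambda>(x, y). K x y) \<in> borel_measurable (S \<Otimes>\<^sub>M N)"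
    and le: "\<And>x. (\<integral>\<^sup>+y. K x y \<partial>distr M N Y) \<le> c"
  shows "(\<integral>\<^sup>+\<omega>. K (X \<omega>) (Y \<omega>) \<partial>M) \<le> c"
proof -
  have XM: "X \<in> M \<rightarrow>\<^sub>M S"
    by (rule measurable_from_subalg[OF sub X])
  interpret X: prob_space "distr M S X"
    by (rule prob_space_distr[OF XM])
  interpret Y: prob_space "distr M N Y"
    by (rule prob_space_distr[OF Y])
  have joint: "distr M S X \<Otimes>\<^sub>M distr M N Y = distr M (S \<Otimes>\<^sub>M N) (\<lambda>\<omega>. (X \<omega>, Y \<omega>))"
  proof (rule pair_measure_eqI)
    fix A B assume "A \<in> sets (distr M S X)" "B \<in> sets (distr M N Y)"
    then have A: "A \<in> sets S" and B: "B \<in> sets N"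
      by simp_all
    have "X -` A \<inter> space M \<in> sets F"
      using measurable_sets[OF X A] sub by (simp add: subalgebra_def)
    then have "prob ((X -` A \<inter> space M) \<inter> (Y -` B \<inter> space M)) = prob (X -` A \<inter> space M) * prob (Y -` B \<inter> space M)"
      using indep B unfolding indep_sets2_eq by blast
    moreover have "(X -` A \<inter> space M) \<inter> (Y -` B \<inter> space M) = (\<lambda>\<omega>. (X \<omega>, Y \<omega>)) -` (A \<times> B) \<inter> space M"
      by auto
    ultimately show "emeasure (distr M S X) A * emeasure (distr M N Y) B
        = emeasure (distr M (S \<Otimes>\<^sub>M N) (\<lambda>\<omega>. (X \<omega>, Y \<omega>))) (A \<times> B)"
      using A B XM Y by (simp add: emeasure_distr emeasure_eq_measure ennreal_mult[symmetric])
  qed (auto intro: X.sigma_finite_measure_axioms Y.sigma_finite_measure_axioms cong: sets_pair_measure_cong)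
  have "(\<integral>\<^sup>+\<omega>. K (X \<omega>) (Y \<omega>) \<partial>M) = (\<integral>\<^sup>+(x, y). K x y \<partial>distr M (S \<Otimes>\<^sub>M N) (\<lambda>\<omega>. (X \<omega>, Y \<omega>)))"
    using K XM Y by (subst nn_integral_distr) auto
  also have "\<dots> = (\<integral>\<^sup>+x. (\<integral>\<^sup>+y. K x y \<partial>distr M N Y) \<partial>distr M S X)"
    unfolding joint[symmetric] using K by (subst Y.nn_integral_fst[symmetric]) auto
  also have "\<dots> \<le> (\<integral>\<^sup>+x. c \<partial>distr M S X)"
    by (intro nn_integral_mono le)
  also have "\<dots> = c"
    by (subst nn_integral_const) (simp only: X.emeasure_space_1 mult_1_right)
  finally show ?thesis .
qed

text \<open>The comparators form an uncountable family, but the condition is closed in \<open>x\<close>, so a countable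
dense subset of \<open>C\<close> suffices.\<close>

lemma sets_Ball_linear_le:
  fixes C :: "'v::euclidean_space set" and S B :: "'a \<Rightarrow> real" and G :: "'a \<Rightarrow> 'v"
  assumes [measurable]: "S \<in> borel_measurable M" "B \<in> borel_measurable M" "G \<in> borel_measurable M"
  shows "{\<omega>\<in>space M. \<forall>x\<in>C. S \<omega> - G \<omega> \<bullet> x \<le> B \<omega>} \<in> sets M"
proof -
  obtain K where K: "countable K" "K \<subseteq> C" "C \<subseteq> closure K"
    by (rule separable)
  have "(\<forall>x\<in>C. S \<omega> - G \<omega> \<bullet> x \<le> B \<omega>) \<longleftrightarrow> (\<forall>x\<in>K. S \<omega> - G \<omega> \<bullet> x \<le> B \<omega>)" for \<omega>
  proof
    assume le: "\<forall>x\<in>K. S \<omega> - G \<omega> \<bullet> x \<le> B \<omega>"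
    have "closed {x. S \<omega> - G \<omega> \<bullet> x \<le> B \<omega>}"
      by (intro closed_Collect_le continuous_intros)
    with le have "closure K \<subseteq> {x. S \<omega> - G \<omega> \<bullet> x \<le> B \<omega>}"
      by (intro closure_minimal) auto
    with K show "\<forall>x\<in>C. S \<omega> - G \<omega> \<bullet> x \<le> B \<omega>"
      by blast
  qed (use K in blast)
  then have "{\<omega>\<in>space M. \<forall>x\<in>C. S \<omega> - G \<omega> \<bullet> x \<le> B \<omega>} = {\<omega>\<in>space M. \<forall>x\<in>K. S \<omega> - G \<omega> \<bullet> x \<le> B \<omega>}"
    by simp
  also have "\<dots> \<in> sets M"
    using K(1) by (intro sets.sets_Collect_countable_All') auto
  finally show ?thesis .
qed

lemma AE_opt_tape: "AE tape in (opt_tape :: ((real^'d) \<times> (real^'d)) measure).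
    fst tape \<in> linf_ball 0 1 \<and> snd tape \<in> linf_ball 0 1"
proof -
  interpret cube: prob_space "cube_measure :: (real^'d) measure"
    by (rule prob_space_cube_measure)
  interpret cubes: pair_sigma_finite "cube_measure :: (real^'d) measure" "cube_measure :: (real^'d) measure" ..
  have cube_sets [measurable]: "linf_ball 0 1 \<in> sets (borel :: (real^'d) measure)"
    by (simp add: linf_ball_eq_cbox)
  have "AE a in (cube_measure :: (real^'d) measure). a \<in> linf_ball 0 1"
    by (rule AE_uniform_measureI) auto
  then show ?thesis
    unfolding opt_tape_def
  proof (intro cubes.AE_pair_measure)
    let ?U = "cube_measure :: (real^'d) measure"
    have "{tape \<in> space (?U \<Otimes>\<^sub>M ?U). fst tape \<in> linf_ball 0 1 \<and> snd tape \<in> linf_ball 0 1}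
        = linf_ball 0 1 \<times> linf_ball 0 1"
      by (auto simp: space_pair_measure)
    also have "\<dots> \<in> sets (?U \<Otimes>\<^sub>M ?U)"
      by (intro pair_measureI) (simp_all add: cube_sets)
    finally show "{tape \<in> space (?U \<Otimes>\<^sub>M ?U).
        fst tape \<in> linf_ball 0 1 \<and> snd tape \<in> linf_ball 0 1}
      \<in> sets (?U \<Otimes>\<^sub>M ?U)" .
  qed auto
qed

section \<open>The high-probability regret bound\<close>

theorem theorem5:
  fixes C :: "(real^'d) set" and r R \<kappa> \<delta> \<rho> :: real
    and mem :: "real^'d \<Rightarrow> real \<Rightarrow> bool"
    and M :: "'a measure" and F :: "nat \<Rightarrow> 'a measure"
    and tape :: "nat \<Rightarrow> 'a \<Rightarrow> (real^'d) \<times> (real^'d)"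
    and loss :: "nat \<Rightarrow> 'a \<Rightarrow> real^'d \<Rightarrow> real"
    and g w x :: "nat \<Rightarrow> 'a \<Rightarrow> real^'d"
    and T :: nat
  assumes "closed C" and "convex C" and "0 < r" and "r \<le> R"
    and "cball 0 r \<subseteq> C" and "C \<subseteq> cball 0 R"
    and "\<kappa> = R / r" and "0 < \<delta>" and "\<delta> < 1/3"
    and "membership_oracle C mem"
    (* F t: information available at round t before the oracle call draws its random tape *)
    and "prob_space M"
    and "\<And>t. t \<ge> 1 \<Longrightarrow> subalgebra M (F t)"
    and "\<And>t. t \<ge> 1 \<Longrightarrow> subalgebra (F (Suc t)) (F t)"
    and "\<And>t. t \<ge> 1 \<Longrightarrow> tape t \<in> F (Suc t) \<rightarrow>\<^sub>M borel"
    and "\<And>t. t \<ge> 1 \<Longrightarrow> distr M borel (tape t) = opt_tape"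
    and "\<And>t. t \<ge> 1 \<Longrightarrow>
           prob_space.indep_set M (sets (F t)) {tape t -` A \<inter> space M | A. A \<in> sets borel}"
    (* the run of the wrapper *)
    and "\<And>t \<omega>. t \<ge> 1 \<Longrightarrow> \<omega> \<in> space M \<Longrightarrow>
           w t \<omega> = wrapper_w (ftrl_proximal R)
                    (\<lambda>s. opt_polar mem r R (\<delta> / (real s)\<^sup>2) (tape s \<omega>)) (\<lambda>s. g s \<omega>) t"
    and "\<And>t \<omega>. t \<ge> 1 \<Longrightarrow> \<omega> \<in> space M \<Longrightarrow>
           x t \<omega> = wrapper_x (ftrl_proximal R)
                    (\<lambda>s. opt_polar mem r R (\<delta> / (real s)\<^sup>2) (tape s \<omega>)) (\<lambda>s. g s \<omega>) t"
    (* the adversary *)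
    and "\<And>t \<omega>. t \<ge> 1 \<Longrightarrow> \<omega> \<in> space M \<Longrightarrow> convex_on C (loss t \<omega>)"
    and "\<And>t \<omega>. t \<ge> 1 \<Longrightarrow> \<omega> \<in> space M \<Longrightarrow> g t \<omega> \<in> subdifferential C (loss t \<omega>) (x t \<omega>)"
    (* iterates and observed subgradients are random vectors that do not anticipate the tape *)
    and "\<And>t. t \<ge> 1 \<Longrightarrow> w t \<in> borel_measurable (F t)"
    and "\<And>t. t \<ge> 1 \<Longrightarrow> x t \<in> borel_measurable (F t)"
    and "\<And>t. t \<ge> 1 \<Longrightarrow> g t \<in> borel_measurable (F t)"
    and "T \<ge> 1" and "0 < \<rho>" and "\<rho> < 1"
  shows "(\<forall>\<omega>\<in>space M. \<forall>t\<in>{1..T}. x t \<omega> \<in> C) \<and>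
    measure M {\<omega>\<in>space M. \<forall>x'\<in>C.
        (\<Sum>t=1..T. g t \<omega> \<bullet> (x t \<omega> - x'))
        \<le> 4 * (1 + \<kappa>) * R * sqrt (\<Sum>t=1..T. (norm (g t \<omega>))\<^sup>2)
          + R * (12 + 10 * \<delta> / \<rho>) * (MAX t\<in>{1..T}. norm (g t \<omega>))}
    \<ge> 1 - \<rho>"
proof -
  note r_pos = assms(3) and r_le_R = assms(4) and \<kappa>_eq = assms(7) and \<delta> = assms(8,9)
    and F_sub = assms(12) and tape_meas = assms(14) and tape_distr = assms(15) and tape_indep = assms(16)
    and run = assms(17,18) and meas = assms(21-23) and T = assms(24) and \<rho> = assms(25)
  define d where "d = real CARD('d)"
  define \<tau> where "\<tau> t = \<delta> / (real t)\<^sup>2" for t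
  define orc where "orc \<omega> = (\<lambda>t. opt_polar mem r R (\<tau> t) (tape t \<omega>))" for \<omega>
  have R: "0 < R"
    using r_pos r_le_R by linarith
  interpret polar_oracle C r R mem d
    using assms by unfold_locales (auto simp: d_def)
  interpret prob_space M
    by (rule assms)
  have w_eq: "w t \<omega> = wrapper_w (ftrl_proximal R) (orc \<omega>) (\<lambda>s. g s \<omega>) t"
    and x_eq: "x t \<omega> = wrapper_x (ftrl_proximal R) (orc \<omega>) (\<lambda>s. g s \<omega>) t"
    if "1 \<le> t" "\<omega> \<in> space M" for t \<omega>
    using run[OF that] by (simp_all add: orc_def \<tau>_def)
  have \<tau>: "0 < \<tau> t" "\<tau> t < 1/3" if "1 \<le> t" for t
  proof -
    have "1 \<le> (real t)\<^sup>2"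
      using that by simp
    then have "\<delta> / (real t)\<^sup>2 \<le> \<delta> / 1"
      using \<delta>(1) that by (intro divide_left_mono) auto
    then show "\<tau> t < 1/3"
      unfolding \<tau>_def using \<delta>(2) by linarith
    show "0 < \<tau> t"
      using \<delta>(1) that by (simp add: \<tau>_def)
  qed
  have in_body: "x t \<omega> \<in> C" if t: "1 \<le> t" and \<omega>: "\<omega> \<in> space M" for t \<omega>
  proof -
    have "norm (w t \<omega>) \<le> R"
      unfolding w_eq[OF t \<omega>] by (rule wrapper_ftrl_regret[OF R])
    from play_in_body[OF \<tau>[OF t] this, of "tape t \<omega>"] show ?thesis
      unfolding x_eq[OF t \<omega>] w_eq[OF t \<omega>] by (simp add: wrapper_x_def Let_def orc_def)
  qed

  \<comment> \<open>The slope gaps, rather than the errors that they bound, are summed: they are measurable functions of iterate and tape.\<close>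
  define Z where "Z \<omega> = (\<Sum>t=1..T. fd_error (\<tau> t) (tape t \<omega>) (w t \<omega>))" for \<omega>
  define c where "c = 6 * \<delta> / (10 * R)"
  have c: "0 < c"
    using \<delta>(1) R by (simp add: c_def)
  have [measurable]: "w t \<in> borel_measurable M" "x t \<in> borel_measurable M" "g t \<in> borel_measurable M"
    "tape t \<in> M \<rightarrow>\<^sub>M borel" if "1 \<le> t" for t
    using measurable_from_subalg[OF F_sub[OF that]] measurable_from_subalg[OF F_sub[of "Suc t"]]
      tape_meas[OF that] meas[OF that] by auto
  have Z_nonneg: "0 \<le> Z \<omega>" for \<omega>
    unfolding Z_def by (intro sum_nonneg fd_error_nonneg \<tau>) auto
  have K_meas: "(\<lambda>q. fd_error (\<tau> t) (snd q) (fst q)) \<in> borel_measurable (borel \<Otimes>\<^sub>M borel)" if "1 \<le> t" for t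
    using fd_error_measurable[OF \<tau>[OF that]] by (simp add: borel_prod)
  have err_meas: "(\<lambda>\<omega>. fd_error (\<tau> t) (tape t \<omega>) (w t \<omega>)) \<in> borel_measurable M" if t: "1 \<le> t" for t
    using measurable_compose[OF measurable_Pair K_meas[OF t], of "w t" M "tape t"] t by simp
  then have Z_meas [measurable]: "Z \<in> borel_measurable M"
    unfolding Z_def by (intro borel_measurable_sum) auto
  have expected_err: "(\<integral>\<^sup>+\<omega>. ennreal (fd_error (\<tau> t) (tape t \<omega>) (w t \<omega>)) \<partial>M) \<le> ennreal (3 * \<tau> t / (10 * R))"
    if t: "1 \<le> t" for t
  proof (rule nn_integral_independent_le[where K = "\<lambda>w tape. ennreal (fd_error (\<tau> t) tape w)" and X = "w t"
        and Y = "tape t"])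
    show "subalgebra M (F t)" "w t \<in> F t \<rightarrow>\<^sub>M borel" "tape t \<in> M \<rightarrow>\<^sub>M borel"
      using F_sub meas(1) t by auto
    show "indep_set (sets (F t)) {tape t -` A \<inter> space M | A. A \<in> sets borel}"
      by (rule tape_indep[OF t])
    show "(\<lambda>(w, tape). ennreal (fd_error (\<tau> t) tape w)) \<in> borel_measurable (borel \<Otimes>\<^sub>M borel)"
      using K_meas[OF t] by (simp add: case_prod_beta)
    show "(\<integral>\<^sup>+tape. ennreal (fd_error (\<tau> t) tape w) \<partial>distr M borel (tape t)) \<le> ennreal (3 * \<tau> t / (10 * R))" for w
      unfolding tape_distr[OF t] by (rule expected_fd_error[OF \<tau>[OF t]])
  qed
  have sum_\<tau>: "(\<Sum>t=1..T. \<tau> t) \<le> 2 * \<delta>"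
  proof -
    have "(\<Sum>t=1..T. \<tau> t) = \<delta> * (\<Sum>t=1..T. 1 / (real t)\<^sup>2)"
      by (simp add: \<tau>_def sum_distrib_left)
    also have "\<dots> \<le> \<delta> * 2"
      using \<delta>(1) by (intro mult_left_mono sum_inverse_squares_le) auto
    finally show ?thesis by simp
  qed
  have "(\<integral>\<^sup>+\<omega>. ennreal (Z \<omega>) \<partial>M) = (\<integral>\<^sup>+\<omega>. (\<Sum>t=1..T. ennreal (fd_error (\<tau> t) (tape t \<omega>) (w t \<omega>))) \<partial>M)"
    unfolding Z_def by (subst sum_ennreal) (auto intro!: fd_error_nonneg \<tau>)
  also have "\<dots> = (\<Sum>t=1..T. \<integral>\<^sup>+\<omega>. ennreal (fd_error (\<tau> t) (tape t \<omega>) (w t \<omega>)) \<partial>M)"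
    using err_meas by (intro nn_integral_sum) auto
  also have "\<dots> \<le> (\<Sum>t=1..T. ennreal (3 * \<tau> t / (10 * R)))"
    by (intro sum_mono expected_err) auto
  also have "\<dots> = ennreal (\<Sum>t=1..T. 3 * \<tau> t / (10 * R))"
    using R by (subst sum_ennreal) (auto intro!: divide_nonneg_nonneg less_imp_le[OF \<tau>(1)])
  also have "(\<Sum>t=1..T. 3 * \<tau> t / (10 * R)) = 3 / (10 * R) * (\<Sum>t=1..T. \<tau> t)"
    by (simp add: sum_distrib_left)
  also have "ennreal \<dots> \<le> ennreal (3 / (10 * R) * (2 * \<delta>))"
    using sum_\<tau> R by (intro ennreal_leI mult_left_mono) auto
  also have "3 / (10 * R) * (2 * \<delta>) = c"
    by (simp add: c_def)
  finally have expected_Z: "(\<integral>\<^sup>+\<omega>. ennreal (Z \<omega>) \<partial>M) \<le> ennreal c" .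

  \<comment> \<open>Markov's inequality at level \<open>c / \<rho>\<close>.\<close>
  have "emeasure M {\<omega>\<in>space M. 1 \<le> ennreal (\<rho> / c) * ennreal (Z \<omega>)}
      \<le> ennreal (\<rho> / c) * (\<integral>\<^sup>+\<omega>. ennreal (Z \<omega>) * indicator (space M) \<omega> \<partial>M)"
    by (rule nn_integral_Markov_inequality) auto
  also have "(\<integral>\<^sup>+\<omega>. ennreal (Z \<omega>) * indicator (space M) \<omega> \<partial>M) = (\<integral>\<^sup>+\<omega>. ennreal (Z \<omega>) \<partial>M)"
    by (intro nn_integral_cong) simp
  also have "ennreal (\<rho> / c) * (\<integral>\<^sup>+\<omega>. ennreal (Z \<omega>) \<partial>M) \<le> ennreal (\<rho> / c) * ennreal c"
    by (intro mult_left_mono expected_Z) simp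
  also have "\<dots> = ennreal \<rho>"
    using c \<rho> by (simp add: ennreal_mult[symmetric])
  also have "{\<omega>\<in>space M. 1 \<le> ennreal (\<rho> / c) * ennreal (Z \<omega>)} = {\<omega>\<in>space M. c / \<rho> \<le> Z \<omega>}"
  proof -
    have "1 \<le> ennreal (\<rho> / c) * ennreal (Z \<omega>) \<longleftrightarrow> c / \<rho> \<le> Z \<omega>" for \<omega>
    proof -
      have "ennreal (\<rho> / c) * ennreal (Z \<omega>) = ennreal (\<rho> / c * Z \<omega>)"
        using c \<rho> Z_nonneg[of \<omega>] by (subst ennreal_mult) auto
      then show ?thesis
        using c \<rho> by (simp add: field_simps)
    qed
    then show ?thesis by simp
  qed
  finally have "prob {\<omega>\<in>space M. c / \<rho> \<le> Z \<omega>} \<le> \<rho>"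
    using \<rho> by (simp add: emeasure_eq_measure)
  moreover have "prob {\<omega>\<in>space M. \<not> c / \<rho> \<le> Z \<omega>} = 1 - prob {\<omega>\<in>space M. c / \<rho> \<le> Z \<omega>}"
    by (rule prob_neg) simp
  ultimately have good: "1 - \<rho> \<le> prob {\<omega>\<in>space M. \<not> c / \<rho> \<le> Z \<omega>}"
    by simp

  \<comment> \<open>The event of the theorem is measurable and contains, up to the null set of tapes outside the cube, the event \<open>Z < c / \<rho>\<close>.\<close>
  let ?bound = "\<lambda>\<omega>. 4 * (1 + \<kappa>) * R * sqrt (\<Sum>t=1..T. (norm (g t \<omega>))\<^sup>2)
    + R * (12 + 10 * \<delta> / \<rho>) * (MAX t\<in>{1..T}. norm (g t \<omega>))"
  let ?E = "{\<omega>\<in>space M. \<forall>x'\<in>C. (\<Sum>t=1..T. g t \<omega> \<bullet> (x t \<omega> - x')) \<le> ?bound \<omega>}"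
  have E_sets: "?E \<in> sets M"
  proof -
    have "(\<lambda>\<omega>. MAX t\<in>{1..T}. norm (g t \<omega>)) \<in> borel_measurable M"
      by (intro borel_measurable_Max) auto
    then have "{\<omega>\<in>space M. \<forall>x'\<in>C. (\<Sum>t=1..T. g t \<omega> \<bullet> x t \<omega>) - (\<Sum>t=1..T. g t \<omega>) \<bullet> x' \<le> ?bound \<omega>} \<in> sets M"
      by (intro sets_Ball_linear_le borel_measurable_add borel_measurable_times borel_measurable_const
          borel_measurable_sqrt borel_measurable_sum borel_measurable_inner borel_measurable_power
          borel_measurable_norm) auto
    then show ?thesis
      by (simp add: inner_diff_right sum_subtractf inner_sum_left)
  qed
  have regret: "\<omega> \<in> ?E" if \<omega>: "\<omega> \<in> space M" and Z: "\<not> c / \<rho> \<le> Z \<omega>"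
    and tapes: "\<And>t. t \<in> {1..T} \<Longrightarrow> fst (tape t \<omega>) \<in> linf_ball 0 1 \<and> snd (tape t \<omega>) \<in> linf_ball 0 1" for \<omega>
  proof -
    define Mx where "Mx = (MAX t\<in>{1..T}. norm (g t \<omega>))"
    define L where "L = sqrt (\<Sum>t=1..T. (norm (g t \<omega>))\<^sup>2)"
    have "norm (g 1 \<omega>) \<le> Mx"
      unfolding Mx_def using T by (intro Max_ge) auto
    then have Mx: "0 \<le> Mx"
      using norm_ge_zero[of "g 1 \<omega>"] by linarith
    have L: "0 \<le> L"
      by (simp add: L_def sum_nonneg)
    have \<kappa>: "0 \<le> \<kappa>"
      using r_pos \<kappa>_eq R by simp
    have "(\<Sum>t=1..T. R * fd_error (\<tau> t) (tape t \<omega>) (w t \<omega>) + \<tau> t) = R * Z \<omega> + (\<Sum>t=1..T. \<tau> t)"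
      by (simp add: sum.distrib sum_distrib_left Z_def)
    also have "\<dots> \<le> R * (c / \<rho>) + 2 * \<delta>"
      using Z R sum_\<tau> by (intro add_mono mult_left_mono) auto
    also have "R * (c / \<rho>) = 6 / 10 * (\<delta> / \<rho>)"
      using R by (simp add: c_def)
    finally have err: "(\<Sum>t=1..T. R * fd_error (\<tau> t) (tape t \<omega>) (w t \<omega>) + \<tau> t) \<le> 6 / 10 * (\<delta> / \<rho>) + 2 * \<delta>" .
    have "(\<Sum>t=1..T. g t \<omega> \<bullet> (x t \<omega> - x')) \<le> ?bound \<omega>" if x': "x' \<in> C" for x'
    proof -
      have "(\<Sum>t=1..T. g t \<omega> \<bullet> (x t \<omega> - x')) \<le> 3 * (1 + \<kappa>) * R * L
          + 5 * R * Mx * (\<Sum>t=1..T. R * fd_error (\<tau> t) (tape t \<omega>) (w t \<omega>) + \<tau> t)"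
        using wrapper_regret[of \<tau> T "\<lambda>t. tape t \<omega>" x' "\<lambda>t. g t \<omega>"] \<tau> tapes T x'
        by (simp add: L_def Mx_def \<kappa>_eq orc_def[symmetric] w_eq[OF _ \<omega>] x_eq[OF _ \<omega>])
      also have "\<dots> \<le> 4 * (1 + \<kappa>) * R * L + 5 * R * Mx * (6 / 10 * (\<delta> / \<rho>) + 2 * \<delta>)"
        using R L Mx \<kappa> err by (intro add_mono mult_left_mono mult_right_mono) auto
      also have "5 * R * Mx * (6 / 10 * (\<delta> / \<rho>) + 2 * \<delta>) = R * Mx * (3 * (\<delta> / \<rho>) + 10 * \<delta>)"
        by (simp add: algebra_simps)
      also have "\<dots> \<le> R * Mx * (12 + 10 * (\<delta> / \<rho>))"
      proof -
        have "0 \<le> \<delta> / \<rho>"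
          using \<delta>(1) \<rho> by simp
        then have "3 * (\<delta> / \<rho>) + 10 * \<delta> \<le> 12 + 10 * (\<delta> / \<rho>)"
          using \<delta>(2) by linarith
        then show ?thesis
          using R Mx by (intro mult_left_mono) auto
      qed
      finally show ?thesis
        by (simp add: L_def Mx_def mult_ac)
    qed
    with \<omega> show ?thesis by simp
  qed
  have "AE \<omega> in M. \<forall>t\<in>{1..T}. fst (tape t \<omega>) \<in> linf_ball 0 1 \<and> snd (tape t \<omega>) \<in> linf_ball 0 1"
  proof (rule AE_finite_allI)
    fix t assume "t \<in> {1..T}"
    then have t: "1 \<le> t" by simp
    show "AE \<omega> in M. fst (tape t \<omega>) \<in> linf_ball 0 1 \<and> snd (tape t \<omega>) \<in> linf_ball 0 1"
    proof -
      have "AE q in distr M borel (tape t). fst q \<in> linf_ball 0 1 \<and> snd q \<in> linf_ball 0 1"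
        unfolding tape_distr[OF t] by (rule AE_opt_tape)
      from AE_distrD[OF _ this] show ?thesis
        using t by simp
    qed
  qed simp
  then have "AE \<omega> in M. \<omega> \<in> {\<omega>\<in>space M. \<not> c / \<rho> \<le> Z \<omega>} \<longrightarrow> \<omega> \<in> ?E"
    by (rule AE_mp) (intro AE_I2 impI, rule regret, auto)
  from finite_measure_mono_AE[OF this E_sets] good have "1 - \<rho> \<le> prob ?E"
    by linarith
  with in_body show ?thesis
    by auto
qed

end
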